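(* Let $p$ be a prime number and $d=p^e$ for some $e\in\mathbb{N}$. Suppose $b$ is an algebraic number such that the critical point $0$ of $f=T^d+b$ is $f$-periodic. Set $\mathfrak{f}=\mathrm{lcm}\{f_v: v\in M_{\mathbb{Q}(b)},\ v\mid p\}$, where $f_v$ denotes the residue degree of the place $v$. Then every algebraic number $\alpha$ that is $f$-preperiodic satisfies $$d^{\,\mathrm{preper}(\alpha)-1}\le[\mathbb{Q}(b,\alpha):\mathbb{Q}(b)]\quad\text{and}\quad\mathrm{per}(\alpha)\le p\,\mathfrak{f}\,[\mathbb{Q}(b,\alpha):\mathbb{Q}(b)].$$
   Context: $\mathbb{N}=\{1,2,\ldots\}$. $M_{\mathbb{Q}(b)}$ is the set of places of the number field $\mathbb{Q}(b)$, and $v\mid p$ means $v$ is a finite place above $p$. $f^{(n)}$ is the $n$-th iterate of $f$, $f^{(0)}=T$. A point $\alpha$ is $f$-preperiodic if its forward orbit $\{f^{(n)}(\alpha):n\ge0\}$ is finite, and $f$-periodic if $f^{(n)}(\alpha)=\alpha$ for some $n\ge1$. For preperiodic $\alpha$, $\mathrm{preper}(\alpha)$ is the least $m\ge0$ such that $f^{(m)}(\alpha)$ is periodic, and $\mathrm{per}(\alpha)$ is the least $n\ge1$ with $f^{(n)}(f^{(m)}(\alpha))=f^{(m)}(\alpha)$ for that $m$ (the period length of the cycle eventually reached). *)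

theory Defs
  imports Complex_Main "HOL-Computational_Algebra.Computational_Algebra"
    "HOL-Algebra.Algebraic_Closure_Type" "HOL-Algebra.Generated_Fields"
begin

text \<open>
  Algebraic numbers are taken inside \<open>\<complex>\<close>, and number fields are subfields of
  \<open>\<complex>\<close>. Every subfield of \<open>\<complex>\<close> contains \<open>\<rat>\<close>, so \<open>\<rat>(S)\<close> is the subfield generated by \<open>S\<close>.
\<close>

abbreviation complex_field :: "complex ring" where
  "complex_field \<equiv> ring_of_type_algebra"

definition rat_adjoin :: "complex set \<Rightarrow> complex set" where
  "rat_adjoin S = generate_field complex_field S"

definition ext_degree :: "complex set \<Rightarrow> complex set \<Rightarrow> nat" where
  "ext_degree L K = ring.dim complex_field K L"


subsection \<open>Places of a subfield of the complex numbers\<close>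

text \<open>
  Absolute values on \<open>K\<close> are represented by functions on all of \<open>\<complex>\<close> of which only the values
  on \<open>K\<close> matter; an equivalence class contains all representations of its members.
\<close>

definition absolute_value_on :: "complex set \<Rightarrow> (complex \<Rightarrow> real) \<Rightarrow> bool" where
  "absolute_value_on K a \<longleftrightarrow>
     (\<forall>x\<in>K. a x \<ge> 0 \<and> (a x = 0 \<longleftrightarrow> x = 0)) \<and>
     (\<forall>x\<in>K. \<forall>y\<in>K. a (x * y) = a x * a y) \<and>
     (\<forall>x\<in>K. \<forall>y\<in>K. a (x + y) \<le> a x + a y)"

definition nontrivial_on :: "complex set \<Rightarrow> (complex \<Rightarrow> real) \<Rightarrow> bool" where
  "nontrivial_on K a \<longleftrightarrow> (\<exists>x\<in>K. x \<noteq> 0 \<and> a x \<noteq> 1)"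

definition nonarchimedean_on :: "complex set \<Rightarrow> (complex \<Rightarrow> real) \<Rightarrow> bool" where
  "nonarchimedean_on K a \<longleftrightarrow> (\<forall>x\<in>K. \<forall>y\<in>K. a (x + y) \<le> max (a x) (a y))"

definition absolute_values :: "complex set \<Rightarrow> (complex \<Rightarrow> real) set" where
  "absolute_values K = {a. absolute_value_on K a \<and> nontrivial_on K a}"

definition absolute_value_equiv :: "complex set \<Rightarrow> ((complex \<Rightarrow> real) \<times> (complex \<Rightarrow> real)) set" where
  "absolute_value_equiv K =
     {(a, a'). a \<in> absolute_values K \<and> a' \<in> absolute_values K \<and>
               (\<exists>s>0. \<forall>x\<in>K. a' x = a x powr s)}"

definition places :: "complex set \<Rightarrow> (complex \<Rightarrow> real) set set" where
  "places K = absolute_values K // absolute_value_equiv K"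

text \<open>
  The conditions below are invariant under equivalence, so for a place \<open>v\<close> quantifying over all
  members of \<open>v\<close> amounts to testing a single representative. A nonarchimedean place lies above
  the prime \<open>p\<close> iff \<open>|p|\<^sub>v < 1\<close>.
\<close>

definition place_above :: "complex set \<Rightarrow> nat \<Rightarrow> (complex \<Rightarrow> real) set \<Rightarrow> bool" where
  "place_above K p v \<longleftrightarrow> (\<forall>a\<in>v. nonarchimedean_on K a \<and> a (of_nat p) < 1)"

definition valuation_ring :: "complex set \<Rightarrow> (complex \<Rightarrow> real) set \<Rightarrow> complex ring" where
  "valuation_ring K v = complex_field \<lparr>carrier := {x \<in> K. \<forall>a\<in>v. a x \<le> 1}\<rparr>"

definition valuation_ideal :: "complex set \<Rightarrow> (complex \<Rightarrow> real) set \<Rightarrow> complex set" where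
  "valuation_ideal K v = {x \<in> K. \<forall>a\<in>v. a x < 1}"

definition residue_field :: "complex set \<Rightarrow> (complex \<Rightarrow> real) set \<Rightarrow> complex set ring" where
  "residue_field K v = valuation_ring K v Quot valuation_ideal K v"

text \<open>
  The residue degree is the degree of the residue field over its prime field \<open>GF(p)\<close>, which is the
  subfield generated by the empty set.
\<close>

definition residue_degree :: "complex set \<Rightarrow> (complex \<Rightarrow> real) set \<Rightarrow> nat" where
  "residue_degree K v =
     ring.dim (residue_field K v) (generate_field (residue_field K v) {})
       (carrier (residue_field K v))"


subsection \<open>Periodic and preperiodic points\<close>

definition periodic_point :: "('a \<Rightarrow> 'a) \<Rightarrow> 'a \<Rightarrow> bool" where
  "periodic_point f x \<longleftrightarrow> (\<exists>n\<ge>1. (f ^^ n) x = x)"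

definition preperiodic_point :: "('a \<Rightarrow> 'a) \<Rightarrow> 'a \<Rightarrow> bool" where
  "preperiodic_point f x \<longleftrightarrow> finite (range (\<lambda>n. (f ^^ n) x))"

definition preper :: "('a \<Rightarrow> 'a) \<Rightarrow> 'a \<Rightarrow> nat" where
  "preper f x = (LEAST m. periodic_point f ((f ^^ m) x))"

definition per :: "('a \<Rightarrow> 'a) \<Rightarrow> 'a \<Rightarrow> nat" where
  "per f x = (LEAST n. n \<ge> 1 \<and> (f ^^ n) ((f ^^ preper f x) x) = (f ^^ preper f x) x)"

end

theory Submission
  imports Defs
begin

text \<open>
  Let \<open>V\<close> be a valuation ring of \<open>\<complex>\<close> whose maximal ideal \<open>M\<close> contains \<open>p\<close>, and \<open>K = \<rat>(b)\<close>, \<open>L = K(\<alpha>)\<close>.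
  Preperiodic points of \<open>f\<close> lie in \<open>V\<close>. As \<open>f(x) - f(y)\<close> is \<open>(x - y)\<^sup>d\<close> up to a multiple of
  \<open>p(x - y)\<close>, \<open>f\<close> is contracting on every residue class, so distinct periodic points are incongruent
  modulo \<open>M\<close>, while \<open>f\<close> is injective on the residue field.

  Period: let \<open>p\<^sup>r\<close> be the order of the residue field of \<open>L\<close>, so that \<open>r\<close> is at most \<open>[L:K]\<close> times a
  residue degree of \<open>K\<close>. On this field \<open>f\<^sup>r\<close> is a translation, hence \<open>f\<^sup>p\<^sup>r\<close> is the identity there,
  and so it fixes the periodic points of \<open>L\<close>.

  Preperiod \<open>m \<ge> 1\<close>: some iterate \<open>\<beta>\<close> of \<open>\<alpha>\<close> is periodic with \<open>f\<^sup>m(\<beta>) = f\<^sup>m(\<alpha>)\<close>. Then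
  \<open>f\<^sup>m\<^sup>-\<^sup>1(\<alpha>)\<close> and \<open>f\<^sup>m\<^sup>-\<^sup>1(\<beta>)\<close> differ by a unit times \<open>\<zeta> - 1\<close> for a nontrivial \<open>d\<close>-th root of
  unity \<open>\<zeta>\<close>; the unit comes from \<open>0\<close> being periodic. Since \<open>\<zeta> - 1\<close> divides \<open>p\<close>, pulling back along \<open>f\<close>
  shows that \<open>(\<alpha> - \<beta>)\<^sup>D\<close> divides \<open>p\<close> for \<open>D = d\<^sup>m\<^sup>-\<^sup>1\<close>. Because \<open>0\<close> is periodic, the Frobenius of \<open>\<int>[b]/p\<close>
  has finite order, so \<open>K\<close> is unramified: nonzero elements of \<open>K\<close> are powers of \<open>p\<close> times units.
  Hence \<open>1, \<alpha> - \<beta>, \<dots>, (\<alpha> - \<beta>)\<^sup>D\<^sup>-\<^sup>1\<close> are linearly independent over \<open>K\<close>.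
\<close>

section \<open>Subrings and subfields of the complex numbers\<close>

lemma complex_is_field: "field complex_field"
  by (rule field_from_type_algebra)

interpretation CF: domain complex_field
  using complex_is_field by (rule field.axioms)

lemma complex_field_simps [simp]:
  "carrier complex_field = UNIV"
  "x \<otimes>\<^bsub>complex_field\<^esub> y = x * y"
  "x \<oplus>\<^bsub>complex_field\<^esub> y = x + y"
  "\<one>\<^bsub>complex_field\<^esub> = 1"
  "\<zero>\<^bsub>complex_field\<^esub> = 0"
  by (simp_all add: ring_of_type_algebra_def)

lemma complex_field_a_inv [simp]: "\<ominus>\<^bsub>complex_field\<^esub> x = - x"
  by (rule CF.minus_equality) simp_all

lemma complex_field_m_inv [simp]: "x \<noteq> 0 \<Longrightarrow> inv\<^bsub>complex_field\<^esub> x = inverse x"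
  by (rule CF.comm_inv_char) simp_all

lemma complex_field_pow [simp]: "x [^]\<^bsub>complex_field\<^esub> (n::nat) = x ^ n"
  by (induction n) (simp_all add: mult.commute)

lemma subring_complex_iff:
  "subring R complex_field \<longleftrightarrow>
     1 \<in> R \<and> (\<forall>x\<in>R. - x \<in> R) \<and> (\<forall>x\<in>R. \<forall>y\<in>R. x + y \<in> R) \<and> (\<forall>x\<in>R. \<forall>y\<in>R. x * y \<in> R)"
proof
  assume "subring R complex_field"
  from subringE[OF this] show
    "1 \<in> R \<and> (\<forall>x\<in>R. - x \<in> R) \<and> (\<forall>x\<in>R. \<forall>y\<in>R. x + y \<in> R) \<and> (\<forall>x\<in>R. \<forall>y\<in>R. x * y \<in> R)"
    by simp
next
  assume "1 \<in> R \<and> (\<forall>x\<in>R. - x \<in> R) \<and> (\<forall>x\<in>R. \<forall>y\<in>R. x + y \<in> R) \<and> (\<forall>x\<in>R. \<forall>y\<in>R. x * y \<in> R)"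
  then show "subring R complex_field"
    by (intro CF.subringI) simp_all
qed

lemma subfield_complex_iff:
  "subfield K complex_field \<longleftrightarrow> subring K complex_field \<and> (\<forall>x\<in>K. inverse x \<in> K)"
proof
  assume K: "subfield K complex_field"
  have "inverse x \<in> K" if "x \<in> K" for x
    using CF.subfield_m_inv(1)[OF K, of x] that by (cases "x = 0") auto
  with subfieldE(1)[OF K] show "subring K complex_field \<and> (\<forall>x\<in>K. inverse x \<in> K)"
    by blast
next
  assume "subring K complex_field \<and> (\<forall>x\<in>K. inverse x \<in> K)"
  then show "subfield K complex_field"
    by (intro field.subfieldI'[OF complex_is_field]) auto
qed

locale complex_subring =
  fixes R :: "complex set"
  assumes subring: "subring R complex_field"
begin

lemma one_mem [simp, intro]: "1 \<in> R"
  and uminus_mem [simp, intro]: "x \<in> R \<Longrightarrow> - x \<in> R"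
  and add_mem [simp, intro]: "x \<in> R \<Longrightarrow> y \<in> R \<Longrightarrow> x + y \<in> R"
  and mult_mem [simp, intro]: "x \<in> R \<Longrightarrow> y \<in> R \<Longrightarrow> x * y \<in> R"
  using subring unfolding subring_complex_iff by blast+

lemma zero_mem [simp, intro]: "0 \<in> R"
  using add_mem[OF one_mem uminus_mem[OF one_mem]] by simp

lemma diff_mem [simp, intro]: "x \<in> R \<Longrightarrow> y \<in> R \<Longrightarrow> x - y \<in> R"
  using add_mem[OF _ uminus_mem, of x y] by simp

lemma power_mem [simp, intro]: "x \<in> R \<Longrightarrow> x ^ n \<in> R"
  by (induction n) auto

lemma of_nat_mem [simp, intro]: "of_nat n \<in> R"
  by (induction n) auto

lemma of_int_mem [simp, intro]: "of_int n \<in> R"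
  by (cases n rule: int_cases2) auto

lemma sum_mem: "(\<And>i. i \<in> I \<Longrightarrow> g i \<in> R) \<Longrightarrow> sum g I \<in> R"
  by (induction I rule: infinite_finite_induct) auto

text \<open>The inner binomial coefficients are multiples of \<open>p\<close>, and every inner term
  contains both \<open>x\<close> and \<open>y\<close>. The factor \<open>x\<close> is kept in the
  error because, with \<open>x\<close> a difference of two points, it makes \<open>f\<close>
  contract.\<close>

lemma freshmans_dream_prime:
  assumes "Factorial_Ring.prime p" "x \<in> R" "y \<in> R"
  shows "\<exists>w\<in>R. (x + y) ^ p = x ^ p + y ^ p + of_nat p * x * y * w"
proof -
  let ?t = "\<lambda>k. of_nat (p choose k) * x ^ k * y ^ (p - k) :: complex"
  have p: "p \<ge> 2"
    using assms(1) by (rule prime_ge_2_nat)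
  have dvd: "p dvd (p choose k)" if "k \<in> {1..<p}" for k
    using that assms(1) by (intro dvd_choose_prime) auto
  have split: "{..p} = insert 0 (insert p {1..<p})"
    using p by auto
  have "(x + y) ^ p = (\<Sum>k\<le>p. ?t k)"
    by (rule binomial_ring)
  also have "\<dots> = y ^ p + x ^ p + (\<Sum>k\<in>{1..<p}. ?t k)"
    using p unfolding split by simp
  also have "(\<Sum>k\<in>{1..<p}. ?t k) =
      of_nat p * x * y * (\<Sum>k\<in>{1..<p}. of_nat ((p choose k) div p) * x ^ (k - 1) * y ^ (p - k - 1))"
    unfolding sum_distrib_left
  proof (rule sum.cong)
    fix k assume k: "k \<in> {1..<p}"
    then have "x ^ k = x * x ^ (k - 1)" "y ^ (p - k) = y * y ^ (p - k - 1)"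
      by (simp_all add: Suc_diff_Suc flip: power_Suc)
    moreover have "of_nat (p choose k) = (of_nat p * of_nat ((p choose k) div p) :: complex)"
      using dvd[OF k] by (metis dvd_mult_div_cancel of_nat_mult)
    ultimately show "?t k = of_nat p * x * y * (of_nat ((p choose k) div p) * x ^ (k - 1) * y ^ (p - k - 1))"
      by simp
  qed simp
  finally have "(x + y) ^ p = x ^ p + y ^ p +
      of_nat p * x * y * (\<Sum>k\<in>{1..<p}. of_nat ((p choose k) div p) * x ^ (k - 1) * y ^ (p - k - 1))"
    by simp
  moreover have "(\<Sum>k\<in>{1..<p}. of_nat ((p choose k) div p) * x ^ (k - 1) * y ^ (p - k - 1)) \<in> R"
    using assms by (intro sum_mem) auto
  ultimately show ?thesis by blast
qed

lemma diff_power_factor: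
  assumes "x \<in> R" "y \<in> R"
  shows "\<exists>w\<in>R. x ^ n - y ^ n = (x - y) * w"
  using assms
proof (induction n)
  case 0
  then show ?case by auto
next
  case (Suc n)
  then obtain w where w: "w \<in> R" "x ^ n - y ^ n = (x - y) * w" by blast
  have "x ^ Suc n - y ^ Suc n = (x - y) * x ^ n + y * (x ^ n - y ^ n)"
    by (simp add: algebra_simps)
  also have "\<dots> = (x - y) * (x ^ n + y * w)"
    unfolding w(2) by (simp add: algebra_simps)
  finally show ?case using w Suc.prems by blast
qed

lemma freshmans_dream:
  assumes "Factorial_Ring.prime p" "x \<in> R" "y \<in> R"
  shows "\<exists>w\<in>R. (x + y) ^ (p ^ e) = x ^ (p ^ e) + y ^ (p ^ e) + of_nat p * x * y * w"
proof (induction e)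
  case 0
  show ?case by (intro bexI[of _ 0]) auto
next
  case (Suc e)
  let ?q = "p ^ e"
  have q: "?q > 0" using prime_gt_0_nat[OF assms(1)] by simp
  obtain w where w: "w \<in> R" "(x + y) ^ ?q = x ^ ?q + y ^ ?q + of_nat p * x * y * w"
    using Suc by blast
  obtain u where u: "u \<in> R" "(x ^ ?q + y ^ ?q) ^ p = (x ^ ?q) ^ p + (y ^ ?q) ^ p + of_nat p * x ^ ?q * y ^ ?q * u"
    using freshmans_dream_prime[OF assms(1), of "x ^ ?q" "y ^ ?q"] assms by auto
  obtain v where v: "v \<in> R" "((x + y) ^ ?q) ^ p - (x ^ ?q + y ^ ?q) ^ p = ((x + y) ^ ?q - (x ^ ?q + y ^ ?q)) * v"
    using diff_power_factor[of "(x + y) ^ ?q" "x ^ ?q + y ^ ?q" p] assms by auto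
  have xq: "x ^ ?q = x * x ^ (?q - 1)" "y ^ ?q = y * y ^ (?q - 1)"
    using q by (simp_all flip: power_Suc)
  \<comment> \<open>The error of the induction hypothesis survives with cofactor \<open>v\<close>;
    the prime case adds a second error, which contains \<open>x * y\<close> because
    \<open>?q > 0\<close>.\<close>
  have "((x + y) ^ ?q) ^ p = (x ^ ?q + y ^ ?q) ^ p + (of_nat p * x * y * w) * v"
    using v(2) unfolding w(2) by (simp add: algebra_simps)
  also have "\<dots> = (x ^ ?q) ^ p + (y ^ ?q) ^ p + of_nat p * x ^ ?q * y ^ ?q * u + of_nat p * x * y * w * v"
    unfolding u(2) by simp
  also have "of_nat p * x ^ ?q * y ^ ?q * u = of_nat p * x * y * (x ^ (?q - 1) * y ^ (?q - 1) * u)"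
    by (subst xq(1), subst xq(2)) (simp add: algebra_simps)
  finally have "(x + y) ^ (p ^ Suc e) = x ^ (p ^ Suc e) + y ^ (p ^ Suc e)
      + of_nat p * x * y * (x ^ (?q - 1) * y ^ (?q - 1) * u + w * v)"
    by (simp add: power_mult[symmetric] algebra_simps)
  moreover have "x ^ (?q - 1) * y ^ (?q - 1) * u + w * v \<in> R"
    using assms u w v by auto
  ultimately show ?case by blast
qed

end

section \<open>Valuation rings\<close>

text \<open>Elements are given as explicit polynomial values because the construction of a valuation
  ring compares degrees of such expressions.\<close>

definition adjoin :: "complex set \<Rightarrow> complex \<Rightarrow> complex set" where
  "adjoin R x = {poly q x | q. \<forall>i. coeff q i \<in> R}"

context complex_subring
begin

lemma adjoin_subring: "subring (adjoin R x) complex_field"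
  unfolding subring_complex_iff
proof (intro conjI ballI)
  show "1 \<in> adjoin R x"
    unfolding adjoin_def by (intro CollectI exI[of _ 1]) (auto simp: coeff_pCons split: nat.split)
next
  fix y assume "y \<in> adjoin R x"
  then obtain q where "\<forall>i. coeff q i \<in> R" "y = poly q x" unfolding adjoin_def by blast
  then show "- y \<in> adjoin R x"
    unfolding adjoin_def by (intro CollectI exI[of _ "- q"]) auto
next
  fix y z assume "y \<in> adjoin R x" "z \<in> adjoin R x"
  then obtain q r where "\<forall>i. coeff q i \<in> R" "y = poly q x" "\<forall>i. coeff r i \<in> R" "z = poly r x"
    unfolding adjoin_def by blast
  then have "y + z = poly (q + r) x \<and> (\<forall>i. coeff (q + r) i \<in> R)"
    "y * z = poly (q * r) x \<and> (\<forall>i. coeff (q * r) i \<in> R)"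
    by (auto simp: coeff_mult intro!: sum_mem)
  then show "y + z \<in> adjoin R x" "y * z \<in> adjoin R x"
    unfolding adjoin_def by blast+
qed

lemma subset_adjoin: "R \<subseteq> adjoin R x"
proof
  fix y assume "y \<in> R"
  then show "y \<in> adjoin R x"
    unfolding adjoin_def by (intro CollectI exI[of _ "[:y:]"]) (auto simp: coeff_pCons split: nat.split)
qed

lemma mem_adjoin: "x \<in> adjoin R x"
  unfolding adjoin_def by (intro CollectI exI[of _ "[:0, 1:]"]) (auto simp: coeff_pCons split: nat.split)

end

text \<open>The ambient field \<open>E\<close> is a parameter because two cases occur: all of the
  complex numbers, where points are reduced, and a number field, for the valuation ring of a
  place.\<close>

locale valuation_subring = complex_subring V for V +
  fixes E :: "complex set"
  assumes E: "subfield E complex_field"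
    and subset_E: "V \<subseteq> E"
    and total: "x \<in> E \<Longrightarrow> x \<in> V \<or> inverse x \<in> V"
begin

sublocale E: complex_subring E
  using E unfolding subfield_complex_iff by (intro complex_subring.intro) blast

lemma E_inverse [simp, intro]: "x \<in> E \<Longrightarrow> inverse x \<in> E"
  using E unfolding subfield_complex_iff by blast

lemma E_divide [simp, intro]: "x \<in> E \<Longrightarrow> y \<in> E \<Longrightarrow> x / y \<in> E"
  unfolding divide_inverse by blast

lemma mem_E [intro]: "x \<in> V \<Longrightarrow> x \<in> E"
  using subset_E by blast

text \<open>The non-units, which form the maximal ideal of a valuation ring. Zero is listed
  separately because \<open>inverse 0 = 0\<close> lies in \<open>V\<close>.\<close>

definition M :: "complex set" where
  "M = {x \<in> V. x = 0 \<or> inverse x \<notin> V}"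

lemma M_mem [intro]: "x \<in> M \<Longrightarrow> x \<in> V"
  by (simp add: M_def)

lemma zero_mem_M [simp]: "0 \<in> M"
  by (simp add: M_def)

lemma one_notin_M [simp]: "1 \<notin> M"
  by (simp add: M_def)

lemma unit_inverse: "x \<in> V \<Longrightarrow> x \<notin> M \<Longrightarrow> inverse x \<in> V"
  and unit_nonzero: "x \<in> V \<Longrightarrow> x \<notin> M \<Longrightarrow> x \<noteq> 0"
  by (auto simp: M_def)

lemma inverse_mem_M: "x \<in> E \<Longrightarrow> x \<notin> V \<Longrightarrow> inverse x \<in> M"
  using total[of x] by (auto simp: M_def)

lemma M_mult:
  assumes x: "x \<in> M" and y: "y \<in> V"
  shows "x * y \<in> M"
proof (cases "x * y = 0")
  case False
  have "inverse (x * y) \<notin> V"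
  proof
    assume "inverse (x * y) \<in> V"
    then have "y * inverse (x * y) \<in> V" using y by blast
    also have "y * inverse (x * y) = inverse x" using False by simp
    finally show False using x False by (auto simp: M_def)
  qed
  then show ?thesis using x y by (auto simp: M_def)
qed (metis zero_mem_M)

lemma M_mult': "x \<in> V \<Longrightarrow> y \<in> M \<Longrightarrow> x * y \<in> M"
  using M_mult[of y x] by (simp add: mult.commute)

text \<open>Of two nonzero elements one divides the other in \<open>V\<close>, so the sum is a
  multiple of one of them.\<close>

lemma M_add [simp, intro]:
  assumes "x \<in> M" "y \<in> M" shows "x + y \<in> M"
proof (cases "x = 0 \<or> y = 0")
  case False
  then consider "x / y \<in> V" | "y / x \<in> V"
    using total[of "x / y"] M_mem[OF assms(1)] M_mem[OF assms(2)] by (auto simp: mem_E)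
  then show ?thesis
  proof cases
    case 1
    then have "y * (x / y + 1) \<in> M" using assms by (intro M_mult) auto
    then show ?thesis using False by (simp add: algebra_simps)
  next
    case 2
    then have "x * (y / x + 1) \<in> M" using assms by (intro M_mult) auto
    then show ?thesis using False by (simp add: algebra_simps)
  qed
qed (use assms in auto)

lemma M_uminus [simp, intro]: "x \<in> M \<Longrightarrow> - x \<in> M"
  using M_mult[of x "-1"] by simp

lemma M_diff [simp, intro]: "x \<in> M \<Longrightarrow> y \<in> M \<Longrightarrow> x - y \<in> M"
  using M_add[of x "- y"] by simp

lemma M_sum: "(\<And>i. i \<in> I \<Longrightarrow> g i \<in> M) \<Longrightarrow> sum g I \<in> M"
  by (induction I rule: infinite_finite_induct) auto

lemma M_prime: "x \<in> V \<Longrightarrow> y \<in> V \<Longrightarrow> x * y \<in> M \<Longrightarrow> x \<in> M \<or> y \<in> M"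
proof (rule ccontr)
  assume "x \<in> V" "y \<in> V" "x * y \<in> M" "\<not> (x \<in> M \<or> y \<in> M)"
  then have "inverse x * inverse y \<in> V" "x * y \<noteq> 0"
    using unit_inverse unit_nonzero by auto
  then show False using \<open>x * y \<in> M\<close> by (auto simp: M_def)
qed

lemma M_power: "x \<in> V \<Longrightarrow> x ^ n \<in> M \<Longrightarrow> x \<in> M"
  by (induction n) (auto dest: M_prime)

lemma power_mem_M: "x \<in> M \<Longrightarrow> n > 0 \<Longrightarrow> x ^ n \<in> M"
  by (cases n) (auto intro: M_mult)

lemma unit_add: "x \<in> V \<Longrightarrow> x \<notin> M \<Longrightarrow> y \<in> M \<Longrightarrow> x + y \<notin> M"
  using M_diff[of "x + y" y] by auto

lemma M_cong_trans: "x - y \<in> M \<Longrightarrow> y - z \<in> M \<Longrightarrow> x - z \<in> M"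
  using M_add[of "x - y" "y - z"] by simp

lemma M_cong_mult:
  assumes "x - x' \<in> M" "y - y' \<in> M" "x' \<in> V" "y \<in> V"
  shows "x * y - x' * y' \<in> M"
proof -
  have "(x - x') * y + x' * (y - y') \<in> M"
    using assms by (intro M_add M_mult M_mult')
  then show ?thesis by (simp add: algebra_simps)
qed

lemma M_cong_power:
  assumes "x - y \<in> M" "x \<in> V" "y \<in> V"
  shows "x ^ n - y ^ n \<in> M"
  by (induction n) (auto intro!: M_cong_mult assms)

text \<open>Divisibility in \<open>V\<close> is a total preorder on the nonzero elements of
  \<open>E\<close>. The chosen term plays the role of one of largest absolute value.\<close>

lemma ex_dominant:
  assumes "finite I" "\<And>i. i \<in> I \<Longrightarrow> t i \<in> E" "\<exists>i\<in>I. t i \<noteq> 0"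
  shows "\<exists>i\<in>I. t i \<noteq> 0 \<and> (\<forall>j\<in>I. t j / t i \<in> V)"
  using assms
proof (induction I rule: finite_induct)
  case (insert k I)
  show ?case
  proof (cases "\<exists>i\<in>I. t i \<noteq> 0")
    case False
    then show ?thesis using insert.prems by auto
  next
    case True
    then obtain i where i: "i \<in> I" "t i \<noteq> 0" "\<forall>j\<in>I. t j / t i \<in> V"
      using insert by auto
    show ?thesis
    proof (cases "t k / t i \<in> V")
      case True
      then show ?thesis using i by auto
    next
      case False
      then have *: "t i / t k \<in> V" "t k \<noteq> 0"
        using total[of "t k / t i"] insert.prems i by auto
      have "t j / t k \<in> V" if "j \<in> I" for j
        using mult_mem[OF i(3)[rule_format, OF that] *(1)] i by simp
      then show ?thesis using * by auto
    qed
  qed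
qed simp

text \<open>In a vanishing sum the largest absolute value is attained twice: after division by a
  dominant term the others add up to -1, so they cannot all lie in \<open>M\<close>.\<close>

lemma sum_eq_0_imp_associated:
  assumes "finite I" "\<And>i. i \<in> I \<Longrightarrow> t i \<in> E" "\<exists>i\<in>I. t i \<noteq> 0" "sum t I = 0"
  shows "\<exists>i\<in>I. \<exists>j\<in>I. i \<noteq> j \<and> t i \<noteq> 0 \<and> t j \<noteq> 0 \<and> t i / t j \<in> V \<and> t j / t i \<in> V"
proof -
  obtain i where i: "i \<in> I" "t i \<noteq> 0" "\<forall>j\<in>I. t j / t i \<in> V"
    using ex_dominant[OF assms(1-3)] by blast
  have "\<exists>j\<in>I - {i}. t j / t i \<notin> M"
  proof (rule ccontr)
    assume "\<not> ?thesis"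
    then have "(\<Sum>j\<in>I - {i}. t j / t i) \<in> M" by (intro M_sum) blast
    moreover have "1 + (\<Sum>j\<in>I - {i}. t j / t i) = sum t I / t i"
      using i assms(1) by (simp add: sum.remove[of I i] sum_divide_distrib add_divide_distrib)
    ultimately show False
      using assms(4) unit_add[of 1] by force
  qed
  then obtain j where j: "j \<in> I" "j \<noteq> i" "t j / t i \<notin> M" by blast
  then have "inverse (t j / t i) \<in> V" "t j / t i \<noteq> 0"
    using i unit_inverse[of "t j / t i"] unit_nonzero[of "t j / t i"] by blast+
  then have "t i / t j \<in> V" "t j \<noteq> 0" by auto
  with i j show ?thesis by blast
qed

end

text \<open>A subring that is maximal among those not containing \<open>1/p\<close> is a valuation ring: elements of
  \<open>1 + pV\<close> are invertible by maximality, and this lets one lower the degree of an expression of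
  \<open>1/p\<close> as a polynomial in \<open>x\<close> by one in \<open>1/x\<close>.\<close>

lemma ex_valuation_subring:
  assumes "Factorial_Ring.prime p"
  shows "\<exists>V. valuation_subring V UNIV \<and> of_nat p \<in> valuation_subring.M V"
proof -
  define A where "A = {R. subring R complex_field \<and> inverse (of_nat p) \<notin> R}"
  have "inverse (of_nat p) \<notin> (\<int> :: complex set)"
  proof
    assume "inverse (of_nat p) \<in> (\<int> :: complex set)"
    then obtain k where "inverse (of_nat p) = (of_int k :: complex)" by (auto elim: Ints_cases)
    then have "of_int (int p * k) = (of_int 1 :: complex)"
      using prime_gt_0_nat[OF assms] by (simp add: field_simps)
    then have "int p * k = 1" by (subst (asm) of_int_eq_iff)
    then have "int p dvd 1" by (metis dvd_triv_left)
    then show False using assms by (simp add: prime_gt_1_nat not_prime_unit)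
  qed
  then have "\<int> \<in> A"
    by (simp add: A_def subring_complex_iff)
  moreover have "\<Union>C \<in> A" if C: "C \<noteq> {}" "subset.chain A C" for C
  proof -
    have sub: "subring R complex_field" "inverse (of_nat p) \<notin> R" if "R \<in> C" for R
      using C that by (auto simp: A_def subset.chain_def)
    have join: "\<exists>R\<in>C. x \<in> R \<and> y \<in> R" if "x \<in> \<Union>C" "y \<in> \<Union>C" for x y
      using C that unfolding subset.chain_def by blast
    have "subring (\<Union>C) complex_field"
      unfolding subring_complex_iff
    proof (intro conjI ballI)
      show "1 \<in> \<Union>C" using C sub unfolding subring_complex_iff by blast
      show "- x \<in> \<Union>C" if "x \<in> \<Union>C" for x using that sub unfolding subring_complex_iff by blast
      show "x + y \<in> \<Union>C" "x * y \<in> \<Union>C" if "x \<in> \<Union>C" "y \<in> \<Union>C" for x y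
        using join[OF that] sub unfolding subring_complex_iff by blast+
    qed
    then show ?thesis using sub by (auto simp: A_def)
  qed
  ultimately obtain V where V: "V \<in> A" "\<And>W. W \<in> A \<Longrightarrow> V \<subseteq> W \<Longrightarrow> W = V"
    using subset_Zorn_nonempty[of A] by blast
  define P :: complex where "P = of_nat p"
  have P0: "P \<noteq> 0" unfolding P_def using prime_gt_0_nat[OF assms] by simp
  interpret complex_subring V
    using V by (intro complex_subring.intro) (simp add: A_def)
  have Pi: "inverse P \<notin> V" using V by (simp add: A_def P_def)
  have PV: "P \<in> V" unfolding P_def by blast
  have no_inv: "P * r \<noteq> 1" if "r \<in> V" for r
    using that Pi by (metis inverse_unique)
  \<comment> \<open>For \<open>x\<close> outside \<open>V\<close> the ring \<open>adjoin V x\<close>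
    is strictly larger than \<open>V\<close>, so by maximality it contains 1/p.\<close>
  have adj: "\<exists>a n. (\<forall>i. a i \<in> V) \<and> inverse P = (\<Sum>i\<le>n. a i * x ^ i)" if "x \<notin> V" for x
  proof -
    have "adjoin V x \<notin> A"
      using V(2)[OF _ subset_adjoin, of x] mem_adjoin[of x] that by auto
    then have "inverse P \<in> adjoin V x"
      using adjoin_subring by (auto simp: A_def P_def)
    then obtain q where "\<forall>i. coeff q i \<in> V" "inverse P = poly q x"
      by (auto simp: adjoin_def)
    then show ?thesis
      by (intro exI[of _ "coeff q"] exI[of _ "degree q"]) (simp add: poly_altdef)
  qed
  \<comment> \<open>If \<open>u = 1 - P * r\<close> had no inverse in \<open>V\<close>, then 1/p
    would be a polynomial in 1/u. Clearing denominators puts \<open>u ^ n / P\<close> into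
    \<open>V\<close>, and \<open>u ^ n\<close> is congruent to 1 modulo \<open>P\<close>, so
    \<open>P\<close> would be invertible.\<close>
  have unit: "inverse (1 - P * r) \<in> V" if r: "r \<in> V" for r
  proof (rule ccontr)
    define u where "u = 1 - P * r"
    assume "inverse (1 - P * r) \<notin> V"
    then have "inverse u \<notin> V" by (simp add: u_def)
    then obtain a n where a: "\<And>i. a i \<in> V" "inverse P = (\<Sum>i\<le>n. a i * inverse u ^ i)"
      using adj by blast
    have u: "u \<noteq> 0" "u \<in> V" using no_inv[OF r] r PV by (auto simp: u_def)
    have "inverse P * u ^ n = (\<Sum>i\<le>n. a i * u ^ (n - i))"
      unfolding a(2) sum_distrib_right
    proof (rule sum.cong)
      fix i assume "i \<in> {..n}"
      then have "u ^ n = u ^ i * u ^ (n - i)" by (simp flip: power_add)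
      then show "a i * inverse u ^ i * u ^ n = a i * u ^ (n - i)"
        using u by (simp add: field_simps)
    qed simp
    also have "\<dots> \<in> V" using a(1) u by (intro sum_mem) auto
    finally have s: "inverse P * u ^ n \<in> V" .
    obtain w where w: "w \<in> V" "1 ^ n - u ^ n = (1 - u) * w"
      using diff_power_factor[OF one_mem u(2)] by blast
    then have "1 = P * (inverse P * u ^ n + r * w)"
      using P0 by (simp add: u_def field_simps)
    then show False using no_inv[of "inverse P * u ^ n + r * w"] s r w by auto
  qed
  \<comment> \<open>\<open>Q x n\<close> says that 1/p has an expression of degree at most
    \<open>n\<close> in \<open>x\<close> over \<open>V\<close>. The aim is that \<open>x\<close> and
    \<open>inverse x\<close> cannot both admit one.\<close>
  define Q where "Q x n \<longleftrightarrow> (\<exists>a. (\<forall>i. a i \<in> V) \<and> 1 = P * (\<Sum>i\<le>n. a i * x ^ i))" for x :: complex and n :: nat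
  have Q_mono: "Q x n" if "Q x m" "m \<le> n" for x m n
  proof -
    obtain a where a: "\<forall>i. a i \<in> V" "1 = P * (\<Sum>i\<le>m. a i * x ^ i)" using \<open>Q x m\<close> unfolding Q_def by blast
    have "(\<Sum>i\<le>n. (if i \<le> m then a i else 0) * x ^ i) = (\<Sum>i\<le>m. a i * x ^ i)"
      using \<open>m \<le> n\<close> by (intro sum.mono_neutral_cong_right) auto
    then show ?thesis
      unfolding Q_def using a by (intro exI[of _ "\<lambda>i. if i \<le> m then a i else 0"]) auto
  qed
  have Q0: "\<not> Q x 0" for x
    using no_inv by (fastforce simp: Q_def)
  have ex_Q: "\<exists>n. Q x n" if "x \<notin> V" for x
    using adj[OF that] P0 unfolding Q_def by (metis right_inverse)
  \<comment> \<open>In the relation for \<open>inverse x\<close> the constant term is moved to the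
    other side, where it leaves the unit \<open>u\<close>. Multiplying by \<open>x ^ Suc n\<close>
    then expresses this power through lower ones, which is substituted into the relation for
    \<open>x\<close>.\<close>
  have reduce: "Q x n" if Q: "Q x (Suc n)" "Q (inverse x) (Suc n)" and x: "x \<noteq> 0" for x n
  proof -
    obtain a where a: "\<And>i. a i \<in> V" "1 = P * (\<Sum>i\<le>Suc n. a i * x ^ i)" using Q unfolding Q_def by blast
    obtain b where b: "\<And>i. b i \<in> V" "1 = P * (\<Sum>i\<le>Suc n. b i * inverse x ^ i)" using Q unfolding Q_def by blast
    define u where "u = 1 - P * b 0"
    have u: "inverse u \<in> V" "u \<noteq> 0"
      using unit[OF b(1)] no_inv[OF b(1)] by (auto simp: u_def)
    have "u = P * (\<Sum>i\<le>Suc n. b i * inverse x ^ i) - P * b 0" using b(2) by (simp add: u_def)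
    also have "\<dots> = P * (\<Sum>i\<le>n. b (Suc i) * inverse x ^ Suc i)"
      unfolding sum.atMost_Suc_shift by (simp add: algebra_simps)
    finally have "u * x ^ Suc n = P * (\<Sum>i\<le>n. b (Suc i) * inverse x ^ Suc i) * x ^ Suc n" by simp
    also have "\<dots> = P * (\<Sum>i\<le>n. b (Suc i) * x ^ (n - i))"
    proof -
      have "(\<Sum>i\<le>n. b (Suc i) * inverse x ^ Suc i) * x ^ Suc n = (\<Sum>i\<le>n. b (Suc i) * x ^ (n - i))"
        unfolding sum_distrib_right
      proof (rule sum.cong)
        fix i assume "i \<in> {..n}"
        then have "x ^ Suc n = x ^ Suc i * x ^ (n - i)" by (simp flip: power_add)
        then show "b (Suc i) * inverse x ^ Suc i * x ^ Suc n = b (Suc i) * x ^ (n - i)"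
          using x by (simp add: field_simps)
      qed simp
      then show ?thesis by simp
    qed
    also have "(\<Sum>i\<le>n. b (Suc i) * x ^ (n - i)) = (\<Sum>i\<le>n. b (Suc (n - i)) * x ^ i)"
      by (rule sum.reindex_bij_witness[of _ "\<lambda>i. n - i" "\<lambda>i. n - i"]) auto
    finally have top: "x ^ Suc n = inverse u * P * (\<Sum>i\<le>n. b (Suc (n - i)) * x ^ i)"
      using u by (simp add: field_simps)
    have "1 = P * ((\<Sum>i\<le>n. a i * x ^ i) + a (Suc n) * x ^ Suc n)"
      using a(2) by simp
    also have "\<dots> = P * (\<Sum>i\<le>n. (a i + a (Suc n) * inverse u * P * b (Suc (n - i))) * x ^ i)"
      unfolding top by (simp add: sum.distrib sum_distrib_left algebra_simps)
    finally show ?thesis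
      unfolding Q_def using a b u PV by (intro exI[of _ "\<lambda>i. a i + a (Suc n) * inverse u * P * b (Suc (n - i))"]) auto
  qed
  have total: "x \<in> V \<or> inverse x \<in> V" for x
  proof (rule ccontr)
    assume "\<not> ?thesis"
    then have x: "x \<notin> V" "inverse x \<notin> V" "x \<noteq> 0" by auto
    define n where "n = (LEAST n. Q x n)"
    define m where "m = (LEAST n. Q (inverse x) n)"
    have n: "Q x n" "\<And>k. k < n \<Longrightarrow> \<not> Q x k"
      unfolding n_def using LeastI_ex[OF ex_Q[OF x(1)]] not_less_Least by blast+
    have m: "Q (inverse x) m" "\<And>k. k < m \<Longrightarrow> \<not> Q (inverse x) k"
      unfolding m_def using LeastI_ex[OF ex_Q[OF x(2)]] not_less_Least by blast+
    obtain n' m' where Suc: "n = Suc n'" "m = Suc m'"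
      using n(1) m(1) Q0 by (metis not0_implies_Suc)
    show False
    \<comment> \<open>The relation of smaller degree is padded with zero coefficients;
      \<open>reduce\<close> then pushes the other one below its minimal degree.\<close>
    proof (cases "m \<le> n")
      case True
      then show False
        using reduce[of x n'] n Q_mono[OF m(1)] x Suc by auto
    next
      case False
      then show False
        using reduce[of "inverse x" m'] m Q_mono[OF n(1), of m] x Suc by auto
    qed
  qed
  interpret valuation_subring V UNIV
    by (intro valuation_subring.intro valuation_subring_axioms.intro complex_subring_axioms) (use total in \<open>auto simp: subfield_complex_iff subring_complex_iff\<close>)
  have "P \<in> M" using PV Pi by (simp add: M_def)
  then show ?thesis
    using valuation_subring_axioms unfolding P_def by blast
qed

section \<open>Residue fields\<close>

text \<open>An independent list in \<open>W\<close> of maximal length spans \<open>W\<close>, and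
  the bound \<open>N\<close> guarantees that a maximal one exists.\<close>

lemma (in ring) dimension_of_bounded_independent:
  assumes K: "subfield K R" and W: "subalgebra K W R"
    and bound: "\<And>Us. independent K Us \<Longrightarrow> set Us \<subseteq> W \<Longrightarrow> length Us \<le> N"
  shows "\<exists>n\<le>N. dimension n K W"
proof -
  define P where "P n \<longleftrightarrow> (\<exists>Us. independent K Us \<and> set Us \<subseteq> W \<and> length Us = n)" for n
  have "P 0" unfolding P_def by (intro exI[of _ "[]"]) auto
  moreover have "\<forall>n. P n \<longrightarrow> n \<le> N" unfolding P_def using bound by auto
  ultimately have "P (Greatest P)" and max: "\<And>n. P n \<Longrightarrow> n \<le> Greatest P"
    by (blast intro: GreatestI_nat, blast intro: Greatest_le_nat)
  then obtain Us where Us: "independent K Us" "set Us \<subseteq> W" "length Us = Greatest P"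
    unfolding P_def by blast
  have "W \<subseteq> Span K Us"
  proof (rule ccontr)
    assume "\<not> W \<subseteq> Span K Us"
    then obtain w where w: "w \<in> W" "w \<notin> Span K Us" by blast
    then have "independent K (w # Us)"
      using Us subalgebra_in_carrier[OF W] by (intro li_Cons) auto
    then have "P (length (w # Us))"
      unfolding P_def using Us(2) w(1) by (intro exI[of _ "w # Us"]) auto
    then have "P (Suc (Greatest P))"
      using Us(3) by simp
    then show False using max by fastforce
  qed
  then have "Span K Us = W"
    using subalgebra_Span_incl[OF K W Us(2)] by blast
  then have "dimension (length Us) K W" using dimensionI[OF K Us(1)] by blast
  then show ?thesis using bound[OF Us(1,2)] by blast
qed

text \<open>Each step in the construction of the dimension adds a vector \<open>v\<close> outside
  \<open>W\<close>, and then the pairs in \<open>K\<close> times \<open>W\<close> correspond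
  bijectively to the elements \<open>k * v + w\<close> of the extension.\<close>

lemma (in ring) card_of_dimension:
  assumes "dimension n K W" "subfield K R" "finite K"
  shows "finite W \<and> card W = card K ^ n"
  using assms
proof (induction rule: dimension.induct)
  case (zero_dim K)
  show ?case by simp
next
  case (Suc_dim v W n K)
  note W = space_subgroup_props[OF Suc_dim.prems(1) Suc_dim.hyps(3)]
  note K = subringE[OF subfieldE(1)[OF Suc_dim.prems(1)]]
  let ?g = "\<lambda>(k, w). k \<otimes> v \<oplus> w"
  have img: "line_extension K v W = ?g ` (K \<times> W)"
    unfolding set_eq_iff line_extension_mem_iff by fastforce
  have "inj_on ?g (K \<times> W)"
  proof (rule inj_onI, safe)
    fix k w k' w' assume kw: "k \<in> K" "w \<in> W" "k' \<in> K" "w' \<in> W"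
      and eq: "k \<otimes> v \<oplus> w = k' \<otimes> v \<oplus> w'"
    have carr: "k \<in> carrier R" "k' \<in> carrier R" "w \<in> carrier R" "w' \<in> carrier R"
      using kw K(1) W(1) by auto
    have "(k \<ominus> k') \<otimes> v = (k \<otimes> v \<oplus> w) \<ominus> (k' \<otimes> v \<oplus> w) "
      using carr Suc_dim.hyps(1) by algebra
    also have "\<dots> = w' \<ominus> w"
      unfolding eq using carr Suc_dim.hyps(1) by algebra
    finally have *: "(k \<ominus> k') \<otimes> v \<in> W"
      using kw W(3,4) by (simp add: a_minus_def)
    have kk: "k \<ominus> k' \<in> K" using kw K(5,7) by (simp add: a_minus_def)
    have "k \<ominus> k' = \<zero>"
      using W(6)[OF _ Suc_dim.hyps(1) *] kk Suc_dim.hyps(2) by blast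
    then show k: "k = k'" using carr by simp
    show "w = w'" using eq carr Suc_dim.hyps(1) unfolding k by simp
  qed
  then show ?case
    using Suc_dim.IH[OF Suc_dim.prems] Suc_dim.prems(2)
    by (simp add: img card_image card_cartesian_product)
qed

text \<open>Lagrange's theorem in the multiplicative group settles the nonzero elements.\<close>

lemma (in field) finite_field_power_card:
  assumes "finite (carrier R)" "x \<in> carrier R"
  shows "x [^] card (carrier R) = x"
proof (cases "x = \<zero>")
  case True
  have "card (carrier R) > 0" using assms by (auto simp: card_gt_0_iff)
  then show ?thesis using True by (metis gr0_implies_Suc nat_pow_Suc nat_pow_closed r_null zero_closed)
next
  case False
  interpret G: group "Multiplicative_Group.mult_of R"
    by (rule field_mult_group)
  have "x [^]\<^bsub>Multiplicative_Group.mult_of R\<^esub> Coset.order (Multiplicative_Group.mult_of R) = \<one>"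
    using G.pow_order_eq_1[of x] False assms by simp
  then have "x [^] (card (carrier R) - 1) = \<one>"
    using assms(1) by (simp add: order_mult_of Coset.order_def Multiplicative_Group.nat_pow_mult_of)
  moreover have "card (carrier R) > 0"
    using assms by (auto simp: card_gt_0_iff)
  then have "card (carrier R) = Suc (card (carrier R) - 1)"
    by simp
  ultimately show ?thesis using assms(2)
    by (metis nat_pow_Suc l_one)
qed

section \<open>The residue field of a valuation ring and the reduction map\<close>

context valuation_subring
begin

text \<open>\<open>Vr\<close> and \<open>F\<close> use the same ring constructions as
  \<open>valuation_ring\<close> and \<open>residue_field\<close>, so for the ring of a place the
  residue fields agree literally.\<close>

definition Vr :: "complex ring" where "Vr = complex_field\<lparr>carrier := V\<rparr>"
definition F :: "complex set ring" where "F = Vr Quot M"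
definition \<pi> :: "complex \<Rightarrow> complex set" where "\<pi> x = M +>\<^bsub>Vr\<^esub> x"

lemma Vr_simps [simp]:
  "carrier Vr = V" "x \<otimes>\<^bsub>Vr\<^esub> y = x * y" "x \<oplus>\<^bsub>Vr\<^esub> y = x + y" "\<one>\<^bsub>Vr\<^esub> = 1" "\<zero>\<^bsub>Vr\<^esub> = 0"
  by (simp_all add: Vr_def)

lemma Vr_cring: "cring Vr"
  unfolding Vr_def by (intro domain.axioms(1) CF.subring_is_domain subring)

lemma Vr_ideal: "ideal M Vr"
proof -
  interpret Vr: cring Vr by (rule Vr_cring)
  have inv: "\<ominus>\<^bsub>Vr\<^esub> x = - x" if "x \<in> V" for x
    using that by (intro Vr.minus_equality) auto
  show ?thesis
  proof (rule idealI[OF Vr.ring_axioms])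
    show "subgroup M (add_monoid Vr)"
    proof (rule Vr.add.subgroupI)
      show "M \<noteq> {}" using zero_mem_M by blast
    qed (use inv in \<open>auto simp: a_inv_def[symmetric] M_mem\<close>)
  qed (auto intro: M_mult M_mult')
qed

lemma \<pi>_eq: "\<pi> x = {m + x | m. m \<in> M}"
  by (auto simp: \<pi>_def a_r_coset_def r_coset_def)

lemma \<pi>_eq_iff: "\<pi> x = \<pi> y \<longleftrightarrow> x - y \<in> M"
proof
  assume "\<pi> x = \<pi> y"
  moreover have "x \<in> \<pi> x" unfolding \<pi>_eq using zero_mem_M by force
  ultimately show "x - y \<in> M" unfolding \<pi>_eq by auto
next
  assume *: "x - y \<in> M"
  show "\<pi> x = \<pi> y"
    unfolding \<pi>_eq
  proof safe
    fix m assume "m \<in> M"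
    then show "\<exists>m'. m + x = m' + y \<and> m' \<in> M" "\<exists>m'. m + y = m' + x \<and> m' \<in> M"
      using * by (intro exI[of _ "m + (x - y)"], auto) (intro exI[of _ "m - (x - y)"], auto)
  qed
qed

lemma \<pi>_hom: "ring_hom_ring Vr F \<pi>"
  unfolding F_def \<pi>_def[abs_def] by (rule ideal.rcos_ring_hom_ring[OF Vr_ideal])

lemma F_simps:
  "carrier F = \<pi> ` V" "\<one>\<^bsub>F\<^esub> = \<pi> 1" "\<zero>\<^bsub>F\<^esub> = \<pi> 0"
  "x \<in> V \<Longrightarrow> y \<in> V \<Longrightarrow> \<pi> x \<oplus>\<^bsub>F\<^esub> \<pi> y = \<pi> (x + y)"
  "x \<in> V \<Longrightarrow> y \<in> V \<Longrightarrow> \<pi> x \<otimes>\<^bsub>F\<^esub> \<pi> y = \<pi> (x * y)"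
  using ring_hom_ring.homh[OF \<pi>_hom] ring_hom_zero[OF ring_hom_ring.homh[OF \<pi>_hom]]
    ring_hom_ring.axioms(1,2)[OF \<pi>_hom]
  by (auto simp: ring_hom_def F_def FactRing_def A_RCOSETS_def' \<pi>_def)

lemma F_cring: "cring F"
  unfolding F_def by (rule ideal.quotient_is_cring[OF Vr_ideal Vr_cring])

lemma F_field: "field F"
proof (rule cring.cring_fieldI2[OF F_cring])
  show "\<zero>\<^bsub>F\<^esub> \<noteq> \<one>\<^bsub>F\<^esub>"
    using \<pi>_eq_iff[of 1 0] by (simp add: F_simps)
  fix a assume "a \<in> carrier F" "a \<noteq> \<zero>\<^bsub>F\<^esub>"
  then obtain x where x: "x \<in> V" "a = \<pi> x" "x \<notin> M"
    using \<pi>_eq_iff[of _ 0] by (auto simp: F_simps)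
  then show "\<exists>b\<in>carrier F. a \<otimes>\<^bsub>F\<^esub> b = \<one>\<^bsub>F\<^esub>"
    using unit_inverse[of x] unit_nonzero[of x]
    by (intro bexI[of _ "\<pi> (inverse x)"]) (simp_all add: F_simps)
qed

lemma \<pi>_uminus: "x \<in> V \<Longrightarrow> \<ominus>\<^bsub>F\<^esub> \<pi> x = \<pi> (- x)"
  using cring.axioms(1)[OF F_cring] by (intro abelian_group.minus_equality ring.axioms(1)) (auto simp: F_simps)

lemma \<pi>_inverse:
  assumes "x \<in> V" "x \<notin> M" shows "inv\<^bsub>F\<^esub> \<pi> x = \<pi> (inverse x)"
  using assms unit_inverse[of x] unit_nonzero[of x] cring.axioms(2)[OF F_cring]
  by (intro comm_monoid.comm_inv_char) (auto simp: F_simps)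

lemma \<pi>_power: "x \<in> V \<Longrightarrow> \<pi> x [^]\<^bsub>F\<^esub> (n::nat) = \<pi> (x ^ n)"
  by (induction n) (auto simp: F_simps nat_pow_def mult.commute)

text \<open>The residue field of \<open>K\<close>, realised inside \<open>F\<close> so that residue
  fields of different subfields can be compared.\<close>

definition resid :: "complex set \<Rightarrow> complex set set" where
  "resid K = \<pi> ` (V \<inter> K)"

lemma subfield_resid:
  assumes K: "subfield K complex_field"
  shows "subfield (resid K) F"
proof -
  interpret K: complex_subring K
    using K unfolding subfield_complex_iff by (intro complex_subring.intro) blast
  have inv: "inverse x \<in> K" if "x \<in> K" for x
    using that K unfolding subfield_complex_iff by blast
  interpret F: cring F by (rule F_cring)
  show ?thesis
  proof (rule field.subfieldI'[OF F_field F.subringI])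
    show "resid K \<subseteq> carrier F" by (auto simp: resid_def F_simps)
    show "\<one>\<^bsub>F\<^esub> \<in> resid K" by (auto simp: resid_def F_simps)
    show "\<ominus>\<^bsub>F\<^esub> h \<in> resid K" if "h \<in> resid K" for h
      using that by (auto simp: resid_def \<pi>_uminus)
    show "h1 \<otimes>\<^bsub>F\<^esub> h2 \<in> resid K" "h1 \<oplus>\<^bsub>F\<^esub> h2 \<in> resid K" if "h1 \<in> resid K" "h2 \<in> resid K" for h1 h2
      using that by (auto simp: resid_def F_simps)
    fix k assume "k \<in> resid K - {\<zero>\<^bsub>F\<^esub>}"
    then obtain x where x: "x \<in> V" "x \<in> K" "k = \<pi> x" "x \<notin> M"
      using \<pi>_eq_iff[of _ 0] by (auto simp: resid_def F_simps)
    then show "inv\<^bsub>F\<^esub> k \<in> resid K"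
      using unit_inverse inv by (auto simp: \<pi>_inverse resid_def)
  qed
qed

lemma \<pi>_combine:
  assumes "set Ks \<subseteq> V" "set Us \<subseteq> V"
  shows "CF.combine Ks Us \<in> V \<and> ring.combine F (map \<pi> Ks) (map \<pi> Us) = \<pi> (CF.combine Ks Us)"
proof -
  interpret F: cring F by (rule F_cring)
  show ?thesis
    using assms by (induction Ks Us rule: CF.combine.induct) (auto simp: F_simps)
qed

text \<open>Dividing a nontrivial relation by its dominant coefficient puts all coefficients into
  \<open>V\<close> and makes one of them 1, so its reduction is still nontrivial.\<close>

lemma independent_lift:
  assumes K: "subfield K complex_field" "K \<subseteq> E" and Us: "set Us \<subseteq> V"
    and indep: "ring.independent F (resid K) (map \<pi> Us)"
  shows "CF.independent K Us"
proof (rule ccontr)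
  assume dep: "\<not> CF.independent K Us"
  interpret F: cring F by (rule F_cring)
  obtain Ks where Ks: "length Ks = length Us" "CF.combine Ks Us = 0" "set Ks \<subseteq> K" "set Ks \<noteq> {0}"
    using CF.dependent_imp_non_trivial_combine[OF K(1) _ dep] by auto
  have "Us \<noteq> []" using dep by auto
  then have "Ks \<noteq> []" using Ks(1) by auto
  then have "\<exists>k\<in>set Ks. k \<noteq> 0" using Ks(4) by (cases Ks) auto
  then obtain c where c: "c \<in> set Ks" "c \<noteq> 0" "\<forall>k\<in>set Ks. k / c \<in> V"
    using ex_dominant[of "set Ks" "\<lambda>k. k"] Ks(3) K(2) by blast
  define Ls where "Ls = map (\<lambda>k. inverse c * k) Ks"
  have Ls: "set Ls \<subseteq> V" "set Ls \<subseteq> K"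
    using c Ks(3) K(1) unfolding Ls_def subfield_complex_iff subring_complex_iff
    by (auto simp: divide_inverse mult.commute subset_iff)
  have "(\<otimes>\<^bsub>complex_field\<^esub>) (inverse c) = (\<lambda>k. inverse c * k)" by auto
  then have "CF.combine Ls Us = inverse c * CF.combine Ks Us"
    using CF.combine_r_distr[of Ks Us "inverse c"] by (simp add: Ls_def)
  then have "F.combine (map \<pi> Ls) (map \<pi> Us) = \<zero>\<^bsub>F\<^esub>"
    using \<pi>_combine[OF Ls(1) Us] Ks(2) by (simp add: F_simps)
  moreover have "set (map \<pi> Ls) \<subseteq> resid K"
    using Ls by (auto simp: resid_def)
  ultimately have "set (take (length (map \<pi> Us)) (map \<pi> Ls)) \<subseteq> {\<zero>\<^bsub>F\<^esub>}"
    using F.independent_imp_trivial_combine[OF subfield_resid[OF K(1)] indep] by blast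
  then have "set (map \<pi> Ls) \<subseteq> {\<zero>\<^bsub>F\<^esub>}"
    using Ks(1) by (simp add: Ls_def)
  moreover have "1 \<in> set Ls"
    using c by (auto simp: Ls_def image_iff intro!: bexI[of _ c])
  ultimately show False
    using \<pi>_eq_iff[of 1 0] by (auto simp: F_simps)
qed

text \<open>A residue extension has at most the degree of the field extension, since independent
  residues lift to independent elements of \<open>L\<close>.\<close>

lemma dimension_resid:
  assumes K: "subfield K complex_field" and L: "subfield L complex_field" "K \<subseteq> L" "L \<subseteq> E"
    and dim: "CF.dimension N K L"
  shows "\<exists>n\<le>N. ring.dimension F n (resid K) (resid L)"
proof -
  interpret F: cring F by (rule F_cring)
  note sub = subfield_resid[OF K] subfield_resid[OF L(1)]
  have "subalgebra (resid K) (resid L) F"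
  proof (intro subalgebra.intro subalgebra_axioms.intro)
    show "subgroup (resid L) (add_monoid F)"
      using subring.axioms(1)[OF subfieldE(1)[OF sub(2)]] .
    show "k \<otimes>\<^bsub>F\<^esub> v \<in> resid L" if "k \<in> resid K" "v \<in> resid L" for k v
      using that subringE(6)[OF subfieldE(1)[OF sub(2)]] L(2) by (auto simp: resid_def)
  qed
  then show ?thesis
  proof (rule F.dimension_of_bounded_independent[OF sub(1)])
    fix Us assume Us: "F.independent (resid K) Us" "set Us \<subseteq> resid L"
    then have "\<forall>u\<in>set Us. \<exists>x. x \<in> V \<inter> L \<and> u = \<pi> x" by (auto simp: resid_def)
    then obtain g where g: "\<And>u. u \<in> set Us \<Longrightarrow> g u \<in> V \<inter> L \<and> u = \<pi> (g u)" by metis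
    then have "map \<pi> (map g Us) = Us" by (auto simp: map_idI)
    then have "CF.independent K (map g Us)"
      using independent_lift[OF K, of "map g Us"] L g Us by auto
    then show "length Us \<le> N"
      using CF.independent_length_le_dimension[OF K dim, of "map g Us"] g by auto
  qed
qed

end

lemma subfield_Rats: "subfield \<rat> complex_field"
  by (auto simp: subfield_complex_iff subring_complex_iff)

lemma Rats_subset_subfield:
  assumes "subfield K complex_field" shows "\<rat> \<subseteq> K"
proof
  fix x :: complex assume "x \<in> \<rat>"
  then obtain a b where "x = of_int a / of_int b" by (auto elim: Rats_cases')
  moreover interpret complex_subring K
    using assms unfolding subfield_complex_iff by (intro complex_subring.intro) blast
  have "inverse (of_int b) \<in> K"
    using assms unfolding subfield_complex_iff by blast
  ultimately show "x \<in> K" by (simp add: divide_inverse)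
qed

section \<open>Residue characteristic \<open>p\<close>: the prime field and the order of the residue
  field\<close>

locale p_valuation_subring = valuation_subring +
  fixes p :: nat
  assumes prime_p: "Factorial_Ring.prime p" and p_mem_M: "of_nat p \<in> M"
begin

text \<open>If \<open>p\<close> did not divide \<open>n\<close>, a Bezout relation would put 1 into
  \<open>M\<close>.\<close>

lemma of_int_mem_M_iff: "of_int n \<in> M \<longleftrightarrow> int p dvd n"
proof
  assume "int p dvd n"
  then obtain k where "n = int p * k" ..
  then show "of_int n \<in> M" using M_mult[OF p_mem_M, of "of_int k"] by auto
next
  assume n: "of_int n \<in> M"
  show "int p dvd n"
  proof (rule ccontr)
    assume "\<not> int p dvd n"
    then have "coprime n (int p)"
      using prime_p prime_imp_coprime[of "int p" n] by (simp add: coprime_commute)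
    then obtain u v where "u * n + v * int p = 1"
      using bezout_int[of n "int p"] by auto
    then have "of_int u * of_int n + of_int v * of_nat p = (1 :: complex)"
      by (metis of_int_1 of_int_add of_int_mult of_int_of_nat_eq)
    moreover have "of_int u * of_int n + of_int v * of_nat p \<in> M"
      using n p_mem_M by (intro M_add M_mult') auto
    ultimately show False by simp
  qed
qed

lemma p_nonzero: "(of_nat p :: complex) \<noteq> 0"
  using prime_gt_0_nat[OF prime_p] by simp

lemma resid_Rats: "resid \<rat> = (\<lambda>i. \<pi> (of_nat i)) ` {..<p}"
proof
  show "(\<lambda>i. \<pi> (of_nat i)) ` {..<p} \<subseteq> resid \<rat>"
    by (auto simp: resid_def)
  show "resid \<rat> \<subseteq> (\<lambda>i. \<pi> (of_nat i)) ` {..<p}"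
  proof
    fix y assume "y \<in> resid \<rat>"
    then obtain r where r: "r \<in> V" "r \<in> \<rat>" "y = \<pi> r" by (auto simp: resid_def)
    obtain a b where ab: "b > 0" "coprime a b" "r = of_int a / of_int b"
      using r(2) by (auto elim: Rats_cases')
    have b: "of_int b \<notin> M"
    proof
      assume b: "of_int b \<in> M"
      then have "of_int b * r \<in> M" using r(1) by (rule M_mult)
      then have "of_int a \<in> M" using ab by simp
      then have "int p dvd a" "int p dvd b" using b by (simp_all add: of_int_mem_M_iff)
      then have "is_unit (int p)" using ab(2) by (rule coprime_common_divisor[rotated])
      then show False using prime_p by (simp add: not_prime_unit)
    qed
    then have "coprime b (int p)"
      using prime_p prime_imp_coprime[of "int p" b] by (simp add: of_int_mem_M_iff coprime_commute)
    then obtain u v where uv: "u * b + v * int p = 1"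
      using bezout_int[of b "int p"] by auto
    \<comment> \<open>\<open>u\<close> inverts \<open>b\<close> modulo \<open>p\<close>, so
      \<open>n\<close> is the integer representing \<open>a / b\<close> modulo
      \<open>M\<close>.\<close>
    define n where "n = (a * u) mod int p"
    have n: "0 \<le> n" "n < int p"
      unfolding n_def using prime_gt_0_nat[OF prime_p] by auto
    have "a - b * n = a * (u * b + v * int p) - b * (a * u - int p * ((a * u) div int p))"
      unfolding uv n_def by (simp add: minus_mult_div_eq_mod)
    also have "\<dots> = int p * (a * v + b * ((a * u) div int p))"
      by (simp add: algebra_simps)
    finally have "of_int (a - b * n) \<in> M" by (simp only: of_int_mem_M_iff dvd_triv_left)
    then have "of_int (a - b * n) * inverse (of_int b) \<in> M"
      using unit_inverse b by (intro M_mult) auto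
    also have "of_int (a - b * n) * inverse (of_int b) = r - of_nat (nat n)"
      using ab n by (simp add: field_simps)
    finally have "y = \<pi> (of_nat (nat n))" using r by (simp add: \<pi>_eq_iff)
    then show "y \<in> (\<lambda>i. \<pi> (of_nat i)) ` {..<p}" using n by (intro image_eqI[of _ _ "nat n"]) auto
  qed
qed

lemma card_resid_Rats: "card (resid \<rat>) = p"
proof -
  have "inj_on (\<lambda>i. \<pi> (of_nat i)) {..<p}"
  proof (rule inj_onI)
    fix i j assume ij: "i \<in> {..<p}" "j \<in> {..<p}" "\<pi> (of_nat i) = \<pi> (of_nat j)"
    then have "of_int (int i - int j) \<in> M" by (simp add: \<pi>_eq_iff)
    then have "int p dvd int i - int j" by (simp only: of_int_mem_M_iff)
    then show "i = j" using ij zdvd_imp_le[of "int p" "int i - int j"] zdvd_imp_le[of "int p" "int j - int i"]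
      by (cases i j rule: linorder_cases) (auto simp: dvd_diff_commute)
  qed
  then show ?thesis by (simp add: resid_Rats card_image)
qed

text \<open>Turns the base field of \<open>residue_degree\<close> into the reduction of the
  rationals, so that \<open>dimension_resid\<close> applies with base field
  \<open>\<rat>\<close>.\<close>

lemma prime_field_eq_resid_Rats: "generate_field F {} = resid \<rat>"
proof
  show "generate_field F {} \<subseteq> resid \<rat>"
    by (intro field.generate_field_min_subfield1[OF F_field] subfield_resid subfield_Rats) auto
  have "\<pi> (of_nat i) \<in> generate_field F {}" for i
  proof (induction i)
    case 0
    show ?case using field.zero_in_generate[OF F_field] by (simp add: F_simps)
  next
    case (Suc i)
    then show ?case
      using generate_field.eng_add[OF generate_field.one Suc] by (simp add: F_simps)
  qed
  then show "resid \<rat> \<subseteq> generate_field F {}" by (auto simp: resid_Rats)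
qed

text \<open>The two bounds on \<open>n\<close> later show that the residue degrees above
  \<open>p\<close> form a finite set without 0, hence with nonzero \<open>Lcm\<close>.\<close>

lemma residue_dim:
  assumes "CF.dimension N \<rat> E"
  defines "n \<equiv> ring.dim F (generate_field F {}) (carrier F)"
  shows "1 \<le> n" "n \<le> N" "finite (carrier F)" "card (carrier F) = p ^ n"
proof -
  interpret F: cring F by (rule F_cring)
  have carr: "carrier F = resid E"
    using subset_E by (auto simp: F_simps resid_def)
  obtain m where m: "m \<le> N" "F.dimension m (resid \<rat>) (carrier F)"
    using dimension_resid[OF subfield_Rats E Rats_subset_subfield[OF E] _ assms(1)]
    unfolding carr by blast
  have n: "n = m"
    using F.dimI[OF subfield_resid[OF subfield_Rats] m(2)]
    unfolding n_def prime_field_eq_resid_Rats over_def by simp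
  have "finite (resid \<rat>)" by (simp add: resid_Rats)
  from F.card_of_dimension[OF m(2) subfield_resid[OF subfield_Rats] this]
  show fin: "finite (carrier F)" and card: "card (carrier F) = p ^ n"
    by (simp_all add: card_resid_Rats n)
  show "n \<le> N" using m n by simp
  have "card {\<zero>\<^bsub>F\<^esub>, \<one>\<^bsub>F\<^esub>} \<le> card (carrier F)"
    using fin by (intro card_mono) auto
  moreover have "\<zero>\<^bsub>F\<^esub> \<noteq> \<one>\<^bsub>F\<^esub>"
    using \<pi>_eq_iff[of 1 0] by (simp add: F_simps)
  ultimately show "1 \<le> n" using card by (cases n) auto
qed

end

section \<open>Fields generated by algebraic numbers\<close>

text \<open>The list polynomials start with the leading coefficient, while \<open>Poly\<close>
  expects the constant one first; hence \<open>rev\<close>.\<close>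

lemma CF_eval_eq_poly: "CF.eval ps x = poly (Poly (rev ps)) x"
  by (induction ps) (simp_all add: Poly_append poly_monom)

lemma algebraic_over_Rats_iff: "(CF.algebraic over \<rat>) x \<longleftrightarrow> Polynomial.algebraic x"
proof
  assume "(CF.algebraic over \<rat>) x"
  then obtain ps where ps: "ps \<in> carrier (\<rat>[X]\<^bsub>complex_field\<^esub>)" "ps \<noteq> []" "CF.eval ps x = 0"
    using CF.algebraicE[OF subfieldE(1)[OF subfield_Rats]] by auto
  then have ps': "set ps \<subseteq> \<rat>" "hd ps \<noteq> 0"
    by (auto simp: univ_poly_def polynomial_def)
  show "Polynomial.algebraic x"
  proof (rule Polynomial.algebraicI'[of "Poly (rev ps)"])
    show "coeff (Poly (rev ps)) i \<in> \<rat>" for i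
      using ps'(1) by (auto simp: coeff_Poly_eq nth_default_def rev_nth)
    show "Poly (rev ps) \<noteq> 0"
    proof
      assume "Poly (rev ps) = 0"
      then obtain n where "rev ps = replicate n 0" by (auto simp: Poly_eq_0)
      moreover have "hd ps \<in> set (rev ps)" using ps(2) by simp
      ultimately show False using ps'(2) by simp
    qed
    show "poly (Poly (rev ps)) x = 0"
      using ps(3) by (simp add: CF_eval_eq_poly)
  qed
next
  assume "Polynomial.algebraic x"
  then obtain q where q: "\<And>i. coeff q i \<in> \<int>" "q \<noteq> 0" "poly q x = 0"
    unfolding Polynomial.algebraic_def by blast
  show "(CF.algebraic over \<rat>) x"
  proof (rule CF.algebraicI[of "rev (coeffs q)"])
    show "rev (coeffs q) \<in> carrier (\<rat>[X]\<^bsub>complex_field\<^esub>)"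
      using q Ints_subset_Rats by (force simp: univ_poly_def polynomial_def hd_rev last_coeffs_eq_coeff_degree coeffs_def)
    show "rev (coeffs q) \<noteq> []" using q by simp
    show "CF.eval (rev (coeffs q)) x = \<zero>\<^bsub>complex_field\<^esub>"
      using q by (simp add: CF_eval_eq_poly)
  qed
qed

lemma algebraic_in_subfield:
  assumes "\<And>x. x \<in> S \<Longrightarrow> Polynomial.algebraic x" "x \<in> rat_adjoin S"
  shows "Polynomial.algebraic x"
proof -
  have "rat_adjoin S \<subseteq> {x \<in> carrier complex_field. (CF.algebraic over \<rat>) x}"
    unfolding rat_adjoin_def
    by (intro field.generate_field_min_subfield1[OF complex_is_field]
        field.subfield_of_algebraics[OF complex_is_field] subfield_Rats)
       (use assms(1) in \<open>auto simp: algebraic_over_Rats_iff\<close>)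
  then show ?thesis using assms(2) by (auto simp: algebraic_over_Rats_iff)
qed

lemma subfield_rat_adjoin: "subfield (rat_adjoin S) complex_field"
  unfolding rat_adjoin_def by (intro field.generate_field_is_subfield[OF complex_is_field]) simp

text \<open>The simple extension of \<open>K\<close> by \<open>x\<close> is a field of finite
  dimension, and the minimality of \<open>L\<close> places \<open>L\<close> inside it.\<close>

lemma ex_dimension_extension:
  assumes K: "subfield K complex_field" and L: "subfield L complex_field" "K \<subseteq> L"
    and x: "Polynomial.algebraic x" and min: "\<And>W. subfield W complex_field \<Longrightarrow> K \<subseteq> W \<Longrightarrow> x \<in> W \<Longrightarrow> L \<subseteq> W"
  shows "\<exists>n. CF.dimension n K L"
proof -
  have x': "(CF.algebraic over K) x"
    using CF.algebraic_mono[OF Rats_subset_subfield[OF K]] x by (simp add: algebraic_over_Rats_iff)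
  let ?W = "CF.simple_extension K x"
  have "subfield ?W complex_field"
    using CF.simple_extension_is_subfield[OF K] x' by simp
  then have LW: "L \<subseteq> ?W"
    using CF.simple_extension_incl[of K x] CF.simple_extension_mem[OF subfieldE(1)[OF K], of x]
    by (intro min) simp_all
  have "CF.finite_dimension K ?W"
    using CF.finite_dimension_simple_extension[OF K] x' by simp
  moreover have "subalgebra K L complex_field"
    using subring.axioms(1)[OF subfieldE(1)[OF L(1)]] subringE(6)[OF subfieldE(1)[OF L(1)]] L(2)
    by (intro subalgebra.intro subalgebra_axioms.intro) auto
  ultimately have "CF.finite_dimension K L"
    using CF.subalbegra_incl_imp_finite_dimension[OF K] LW by blast
  then show ?thesis by (auto simp: CF.finite_dimension_def)
qed

lemma ex_dimension_rat_adjoin: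
  assumes "Polynomial.algebraic x"
  shows "\<exists>n. CF.dimension n (rat_adjoin S) (rat_adjoin (insert x S))"
proof (rule ex_dimension_extension[OF subfield_rat_adjoin subfield_rat_adjoin _ assms])
  show "rat_adjoin S \<subseteq> rat_adjoin (insert x S)"
    unfolding rat_adjoin_def by (intro field.mono_generate_field[OF complex_is_field]) auto
  fix W assume W: "subfield W complex_field" "rat_adjoin S \<subseteq> W" "x \<in> W"
  have "S \<subseteq> rat_adjoin S"
    unfolding rat_adjoin_def by (auto intro: generate_field.incl)
  then show "rat_adjoin (insert x S) \<subseteq> W"
    using W unfolding rat_adjoin_def
    by (intro field.generate_field_min_subfield1[OF complex_is_field]) auto
qed

lemma rat_adjoin_empty: "rat_adjoin {} = \<rat>"
  unfolding rat_adjoin_def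
  using field.generate_field_min_subfield1[OF complex_is_field, of "{}" \<rat>] subfield_Rats
    Rats_subset_subfield[OF field.generate_field_is_subfield[OF complex_is_field, of "{}"]]
  by auto

lemma ex_dimension_rat_adjoin_singleton:
  assumes "Polynomial.algebraic x" shows "\<exists>n. CF.dimension n \<rat> (rat_adjoin {x})"
  using ex_dimension_rat_adjoin[OF assms, of "{}"] by (simp add: rat_adjoin_empty)

lemma ext_degree_eq:
  assumes "subfield K complex_field" "CF.dimension n K L"
  shows "ext_degree L K = n"
  using CF.dimI[OF assms] by (simp add: ext_degree_def over_def)

section \<open>Reduction of preperiodic points\<close>

lemma preperiodic_pointE:
  assumes "preperiodic_point f x"
  obtains i j where "i < j" "(f ^^ i) x = (f ^^ j) x"
proof -
  have "\<not> inj (\<lambda>n. (f ^^ n) x)"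
    using assms finite_imageD[of "\<lambda>n. (f ^^ n) x" UNIV] by (auto simp: preperiodic_point_def)
  then obtain i j where "i \<noteq> j" "(f ^^ i) x = (f ^^ j) x" by (auto simp: inj_on_def)
  then show thesis using that[of i j] that[of j i] by (cases "i < j") auto
qed

lemma funpow_diff_fixed:
  assumes "i < j" "(f ^^ i) x = (f ^^ j) x"
  shows "(f ^^ (j - i)) ((f ^^ i) x) = (f ^^ i) x"
proof -
  have "(f ^^ (j - i)) ((f ^^ i) x) = (f ^^ (j - i + i)) x"
    by (simp only: funpow_add comp_apply)
  then show ?thesis using assms by simp
qed

lemma ex_periodic_iterate:
  assumes "preperiodic_point f x"
  shows "\<exists>m. periodic_point f ((f ^^ m) x)"
proof -
  obtain i j where ij: "i < j" "(f ^^ i) x = (f ^^ j) x"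
    using assms by (rule preperiodic_pointE)
  then have "(f ^^ (j - i)) ((f ^^ i) x) = (f ^^ i) x"
    by (rule funpow_diff_fixed)
  with ij(1) show ?thesis
    by (intro exI[of _ i]) (auto simp: periodic_point_def intro!: exI[of _ "j - i"])
qed

lemma funpow_fixed_mult: "(f ^^ n) x = x \<Longrightarrow> (f ^^ (n * k)) x = x"
  by (induction k) (simp_all add: funpow_add)

lemma periodic_point_iterate: "periodic_point f x \<Longrightarrow> periodic_point f ((f ^^ k) x)"
  unfolding periodic_point_def
  by (metis add.commute comp_apply funpow_add)

context p_valuation_subring
begin

lemma int_dvd_of_factor:
  assumes "of_int N = of_nat p ^ j * s" "s \<in> V"
  shows "int p ^ j dvd N"
  using assms
proof (induction j arbitrary: N)
  case (Suc j)
  have "of_int N = of_nat p * (of_nat p ^ j * s)" using Suc.prems by simp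
  also have "\<dots> \<in> M" using Suc.prems by (intro M_mult[OF p_mem_M]) auto
  finally obtain N' where N': "N = int p * N'" by (auto simp: of_int_mem_M_iff)
  then have "of_int N' = of_nat p ^ j * s" using Suc.prems p_nonzero by simp
  then have "int p ^ j dvd N'" using Suc by blast
  then show ?case using N' by simp
qed simp

text \<open>\<open>V\<close> may contain nonzero elements divisible by every power of
  \<open>p\<close>. A nonzero algebraic \<open>x\<close> is not one of them: it divides the nonzero
  constant coefficient of an integer polynomial, and \<open>int_dvd_of_factor\<close> carries
  divisibility down to the integers.\<close>

lemma algebraic_not_infinitely_divisible:
  assumes "Polynomial.algebraic x" "x \<noteq> 0"
  shows "\<exists>j. \<forall>s\<in>V. x \<noteq> of_nat p ^ j * s"
proof (rule ccontr)
  assume "\<not> ?thesis"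
  then have div: "\<exists>s\<in>V. x = of_nat p ^ j * s" for j by blast
  then have "x \<in> V" by (metis mult_1 power_0)
  obtain q where q: "coeff q 0 \<noteq> 0" "poly (map_poly of_int q) x = 0"
    using algebraicE'_nonzero[OF assms] by blast
  obtain c r where cr: "q = pCons c r" by (cases q)
  have c: "c \<noteq> 0" using q(1) cr by simp
  define z where "z = - poly (map_poly of_int r) x"
  have z: "of_int c = x * z"
    using q(2) unfolding cr z_def by (simp add: map_poly_pCons eq_neg_iff_add_eq_0)
  have "poly (map_poly of_int r) x \<in> V"
    unfolding poly_altdef using \<open>x \<in> V\<close> by (intro sum_mem) (auto simp: coeff_map_poly)
  then have "z \<in> V" by (simp add: z_def)
  \<comment> \<open>Any exponent with \<open>p ^ j\<close> above the absolute value of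
    \<open>c\<close> would do.\<close>
  define j where "j = nat \<bar>c\<bar>"
  obtain s where "s \<in> V" "x = of_nat p ^ j * s" using div by blast
  then have "of_int c = of_nat p ^ j * (s * z)" "s * z \<in> V"
    using z \<open>z \<in> V\<close> by auto
  then have "int p ^ j dvd c" by (rule int_dvd_of_factor)
  then have "int p ^ j \<le> \<bar>c\<bar>" using dvd_imp_le_int[of c "int p ^ j"] c by simp
  moreover have "int j < int p ^ j"
    using less_exp[of j] power_mono[of 2 p j] prime_ge_2_nat[OF prime_p]
    by (metis less_le_trans of_nat_less_iff of_nat_power zero_le)
  ultimately show False by (simp add: j_def)
qed

end

section \<open>Integrality of preperiodic points and the action of \<open>f\<close> modulo
  \<open>M\<close>\<close>

locale unicritical = p_valuation_subring V UNIV p for V p +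
  fixes e d :: nat and b :: complex and f :: "complex \<Rightarrow> complex"
  assumes e: "e \<ge> 1" and d: "d = p ^ e" and f: "f = (\<lambda>z. z ^ d + b)"
    and zero_periodic: "periodic_point f 0" and algebraic_b: "Polynomial.algebraic b"
begin

lemma d_ge_2: "d \<ge> 2"
proof -
  have "p ^ 1 \<le> p ^ e" using e prime_gt_0_nat[OF prime_p] by (intro power_increasing) auto
  then show ?thesis using prime_ge_2_nat[OF prime_p] by (simp add: d)
qed

lemma f_zero: "f 0 = b"
  using d_ge_2 by (simp add: f)

text \<open>A point outside \<open>V\<close> that dominates \<open>b\<close> escapes: its iterates grow strictly.\<close>

lemma escape_step:
  assumes "x \<notin> V" "b / x \<in> V"
  shows "f x \<notin> V" "x / f x \<in> M" "b / f x \<in> V"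
proof -
  have x0: "x \<noteq> 0" using assms by auto
  have ix: "inverse x \<in> M" using inverse_mem_M assms by auto
  \<comment> \<open>This gives \<open>f x = x * s\<close>. The first summand lies outside
    \<open>V\<close> and the second inside, so \<open>s\<close> is outside \<open>V\<close> and
    \<open>inverse s\<close> is in \<open>M\<close>.\<close>
  define s where "s = x ^ (d - 1) + b / x"
  have "x ^ (d - 1) \<notin> V"
  proof
    assume "x ^ (d - 1) \<in> V"
    moreover have "inverse x ^ (d - 1) \<in> M" using d_ge_2 by (intro power_mem_M ix) auto
    ultimately have "inverse x ^ (d - 1) * x ^ (d - 1) \<in> M" by (intro M_mult)
    then show False using x0 by (simp flip: power_mult_distrib)
  qed
  then have s: "s \<notin> V" using diff_mem[of s "b / x"] assms by (auto simp: s_def)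
  then have s0: "s \<noteq> 0" and is_M: "inverse s \<in> M" using inverse_mem_M by auto
  have "x ^ d = x * x ^ (d - 1)" using d_ge_2 by (simp flip: power_Suc)
  then have fx: "f x = x * s" using x0 by (simp add: f s_def algebra_simps)
  show "x / f x \<in> M" using x0 is_M by (simp add: fx field_simps)
  show "f x \<notin> V"
  proof
    assume "f x \<in> V"
    then have "inverse s * f x \<in> V" using is_M by auto
    then show False using assms(1) s0 by (simp add: fx field_simps)
  qed
  have "b / x * inverse s \<in> V" by (rule mult_mem[OF assms(2) M_mem[OF is_M]])
  then show "b / f x \<in> V" by (simp add: fx field_simps)
qed

lemma escape:
  assumes "x \<notin> V" "b / x \<in> V"
  shows "(f ^^ n) x \<notin> V \<and> b / (f ^^ n) x \<in> V \<and> (n > 0 \<longrightarrow> x / (f ^^ n) x \<in> M)"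
proof (induction n)
  case (Suc n)
  let ?y = "(f ^^ n) x"
  have y: "?y \<notin> V" "b / ?y \<in> V" using Suc by auto
  have y0: "?y \<noteq> 0" using y by auto
  have "x / ?y \<in> V"
    using Suc assms by (cases "n = 0") auto
  moreover have "?y / f ?y \<in> M" using escape_step[OF y] by blast
  ultimately have "x / ?y * (?y / f ?y) \<in> M" by (rule M_mult')
  then show ?case using escape_step[OF y] y0 by simp
qed (use assms in auto)

lemma no_escape:
  assumes "x \<notin> V" "b / x \<in> V" "i < j"
  shows "(f ^^ i) x \<noteq> (f ^^ j) x"
proof
  assume eq: "(f ^^ i) x = (f ^^ j) x"
  let ?y = "(f ^^ i) x"
  have y: "?y \<notin> V" "b / ?y \<in> V" using escape[OF assms(1,2)] by blast+
  have "(f ^^ (j - i)) ?y = ?y"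
    using \<open>i < j\<close> eq by (rule funpow_diff_fixed)
  then have "?y / ?y \<in> M" using escape[OF y, of "j - i"] \<open>i < j\<close> by simp
  moreover have "?y \<noteq> 0" using y by auto
  ultimately show False by simp
qed

text \<open>Outside \<open>V\<close> the point \<open>b\<close> would dominate itself and hence
  escape, but \<open>b = f 0\<close> is periodic.\<close>

lemma b_mem: "b \<in> V"
proof (rule ccontr)
  assume b: "b \<notin> V"
  obtain n where n: "n \<ge> 1" "(f ^^ n) 0 = 0"
    using zero_periodic by (auto simp: periodic_point_def)
  have "(f ^^ n) b = f ((f ^^ n) 0)"
    using funpow_swap1[of f n 0] f_zero by simp
  then have "(f ^^ 0) b = (f ^^ n) b" using n f_zero by simp
  moreover have "b / b \<in> V" using b by auto
  ultimately show False using no_escape[OF b, of 0 n] n by auto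
qed

lemma f_mem [intro]: "x \<in> V \<Longrightarrow> f x \<in> V"
  using b_mem by (auto simp: f)

lemma iterate_mem [intro]: "x \<in> V \<Longrightarrow> (f ^^ n) x \<in> V"
  by (induction n) auto

lemma preperiodic_mem:
  assumes "preperiodic_point f x" shows "x \<in> V"
proof (rule ccontr)
  assume x: "x \<notin> V"
  then have "inverse x \<in> V" using inverse_mem_M by auto
  then have "b / x \<in> V" using b_mem by (auto simp: divide_inverse)
  then show False using assms no_escape[OF x] by (auto elim: preperiodic_pointE)
qed

lemma f_diff:
  assumes "x \<in> V" "y \<in> V"
  shows "\<exists>w\<in>V. f x - f y = (x - y) ^ d + of_nat p * (x - y) * w"
proof -
  obtain w where "w \<in> V" "((x - y) + y) ^ d = (x - y) ^ d + y ^ d + of_nat p * (x - y) * y * w"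
    using freshmans_dream[OF prime_p, of "x - y" y e] assms unfolding d by blast
  then show ?thesis using assms by (intro bexI[of _ "y * w"]) (auto simp: f)
qed

text \<open>Both terms of \<open>f_diff\<close> contain \<open>x - y\<close>. The cofactors are
  \<open>(x - y) ^ (d - 1)\<close>, in \<open>M\<close> since \<open>d\<close> is at least 2, and a
  multiple of \<open>p\<close>.\<close>

lemma f_contracts:
  assumes "x \<in> V" "y \<in> V" "x - y \<in> M"
  shows "\<exists>w\<in>M. f x - f y = (x - y) * w"
proof -
  obtain w where w: "w \<in> V" "f x - f y = (x - y) ^ d + of_nat p * (x - y) * w"
    using f_diff assms by blast
  have "(x - y) ^ d = (x - y) * (x - y) ^ (d - 1)" using d_ge_2 by (simp flip: power_Suc)
  then have "f x - f y = (x - y) * (x - y) ^ (d - 1) + (x - y) * (of_nat p * w)"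
    using w(2) by (simp add: mult_ac)
  then have "f x - f y = (x - y) * ((x - y) ^ (d - 1) + of_nat p * w)"
    by (simp only: distrib_left)
  moreover have "(x - y) ^ (d - 1) + of_nat p * w \<in> M"
    using d_ge_2 w p_mem_M by (intro M_add power_mem_M M_mult assms) auto
  ultimately show ?thesis by blast
qed

lemma iterate_contracts:
  assumes "x \<in> V" "y \<in> V" "x - y \<in> M"
  shows "\<exists>w\<in>V. (f ^^ n) x - (f ^^ n) y = (x - y) * w \<and> (n > 0 \<longrightarrow> w \<in> M)"
proof (induction n)
  case (Suc n)
  then obtain w where w: "w \<in> V" "(f ^^ n) x - (f ^^ n) y = (x - y) * w" by blast
  then have "(f ^^ n) x - (f ^^ n) y \<in> M" using assms by (auto intro: M_mult)
  then obtain v where v: "v \<in> M" "f ((f ^^ n) x) - f ((f ^^ n) y) = (x - y) * w * v"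
    using f_contracts[of "(f ^^ n) x" "(f ^^ n) y"] assms w by auto
  then show ?case using w by (intro bexI[of _ "w * v"]) (auto intro: M_mult')
qed auto

text \<open>Iterating over a common period \<open>n * m\<close> gives
  \<open>x - y = (x - y) * w\<close> with \<open>w\<close> in \<open>M\<close>, and \<open>w\<close>
  cannot be 1.\<close>

lemma periodic_eqI:
  assumes x: "periodic_point f x" "x \<in> V" and y: "periodic_point f y" "y \<in> V" and "x - y \<in> M"
  shows "x = y"
proof -
  obtain n where n: "n \<ge> 1" "(f ^^ n) x = x" using x by (auto simp: periodic_point_def)
  obtain m where m: "m \<ge> 1" "(f ^^ m) y = y" using y by (auto simp: periodic_point_def)
  have "(f ^^ (n * m)) x = x" "(f ^^ (n * m)) y = y"
    using funpow_fixed_mult[OF n(2)] funpow_fixed_mult[OF m(2), of n] by (simp_all add: mult.commute)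
  then obtain w where w: "w \<in> M" "x - y = (x - y) * w"
    using iterate_contracts[OF x(2) y(2) assms(5), of "n * m"] n m by auto
  then show ?thesis using one_notin_M by auto
qed

text \<open>On the residue field \<open>f\<close> is an additive Frobenius power followed by a
  translation, so each iterate has the same shape, with its value at 0 as translation.\<close>

lemma iterate_cong:
  assumes "x \<in> V"
  shows "(f ^^ k) x - (x ^ (d ^ k) + (f ^^ k) 0) \<in> M"
proof (induction k)
  case 0
  show ?case by simp
next
  case (Suc k)
  let ?c = "(f ^^ k) 0" and ?y = "x ^ (d ^ k)"
  have c: "?c \<in> V" by auto
  obtain w where w: "w \<in> V" "(?y + ?c) ^ d = ?y ^ d + ?c ^ d + of_nat p * ?y * ?c * w"
    using freshmans_dream[OF prime_p, of ?y ?c e] assms c unfolding d by blast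
  have "((f ^^ k) x) ^ d - (?y + ?c) ^ d \<in> M"
    using Suc assms c by (intro M_cong_power) auto
  moreover have "of_nat p * (?y * ?c * w) \<in> M"
    using assms c w by (intro M_mult p_mem_M) auto
  ultimately have "((f ^^ k) x) ^ d - (?y + ?c) ^ d + of_nat p * (?y * ?c * w) \<in> M" by (rule M_add)
  also have "((f ^^ k) x) ^ d - (?y + ?c) ^ d + of_nat p * (?y * ?c * w) =
      (f ^^ Suc k) x - (x ^ (d ^ Suc k) + (f ^^ Suc k) 0)"
    unfolding w(2) by (simp add: f power_mult[symmetric] mult.commute algebra_simps)
  finally show ?case .
qed

end

section \<open>The field generated by the parameter is unramified\<close>

context unicritical
begin

definition Zb :: "complex set" where "Zb = generate_ring complex_field {b}"
definition K :: "complex set" where "K = rat_adjoin {b}"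

lemma subfield_K: "subfield K complex_field"
  unfolding K_def by (rule subfield_rat_adjoin)

lemma b_mem_K: "b \<in> K"
  unfolding K_def rat_adjoin_def by (rule generate_field.incl) simp

sublocale Zb: complex_subring Zb
  unfolding Zb_def by (intro complex_subring.intro CF.generate_ring_is_subring) simp

sublocale K: complex_subring K
  using subfield_K unfolding subfield_complex_iff by (intro complex_subring.intro) blast

lemma b_mem_Zb: "b \<in> Zb"
  unfolding Zb_def by (rule generate_ring.incl) simp

lemma Zb_subset:
  assumes "complex_subring R" "b \<in> R" shows "Zb \<subseteq> R"
  using CF.generate_ring_min_subring1[OF _ complex_subring.subring[OF assms(1)]] assms(2)
  by (simp add: Zb_def)

lemma Zb_subset_V: "Zb \<subseteq> V"
  using b_mem by (intro Zb_subset complex_subring_axioms)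

lemma Zb_subset_K: "Zb \<subseteq> K"
  using b_mem_K by (intro Zb_subset K.complex_subring_axioms)

lemma algebraic_K: "x \<in> K \<Longrightarrow> Polynomial.algebraic x"
  using algebraic_in_subfield[of "{b}" x] algebraic_b by (simp add: K_def)

text \<open>Reduces the valuation of \<open>K\<close> to that of \<open>Zb\<close>, where the
  Frobenius argument takes place.\<close>

lemma K_fraction:
  assumes "x \<in> K" shows "\<exists>y\<in>Zb. \<exists>z\<in>Zb. z \<noteq> 0 \<and> x = y / z"
  using assms unfolding K_def rat_adjoin_def
proof (induction rule: generate_field.induct)
  case one
  show ?case by (intro bexI[of _ 1]) auto
next
  case (incl h)
  then show ?case using b_mem_Zb by (intro bexI[of _ b] bexI[of _ 1]) auto
next
  case (a_inv h)
  then obtain y z where "y \<in> Zb" "z \<in> Zb" "z \<noteq> 0" "h = y / z" by blast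
  then show ?case by (intro bexI[of _ "- y"] bexI[of _ z]) auto
next
  case (m_inv h)
  then obtain y z where "y \<in> Zb" "z \<in> Zb" "z \<noteq> 0" "h = y / z" by blast
  then show ?case using m_inv by (intro bexI[of _ z] bexI[of _ y]) auto
next
  case (eng_add h1 h2)
  then obtain y z y' z' where "y \<in> Zb" "z \<in> Zb" "z \<noteq> 0" "h1 = y / z"
    "y' \<in> Zb" "z' \<in> Zb" "z' \<noteq> 0" "h2 = y' / z'" by blast
  then show ?case by (intro bexI[of _ "y * z' + y' * z"] bexI[of _ "z * z'"]) (auto simp: add_frac_eq)
next
  case (eng_mult h1 h2)
  then obtain y z y' z' where "y \<in> Zb" "z \<in> Zb" "z \<noteq> 0" "h1 = y / z"
    "y' \<in> Zb" "z' \<in> Zb" "z' \<noteq> 0" "h2 = y' / z'" by blast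
  then show ?case by (intro bexI[of _ "y * y'"] bexI[of _ "z * z'"]) auto
qed

text \<open>Congruences are taken modulo this ideal, which may be smaller than the trace of
  \<open>M\<close> on \<open>Zb\<close>, because they must permit exact division by
  \<open>p\<close>.\<close>

definition pZb :: "complex set" where "pZb = {of_nat p * y | y. y \<in> Zb}"

lemma pZbI: "y \<in> Zb \<Longrightarrow> of_nat p * y \<in> pZb"
  by (auto simp: pZb_def)

lemma pZb_add: "x \<in> pZb \<Longrightarrow> y \<in> pZb \<Longrightarrow> x + y \<in> pZb"
  unfolding pZb_def by (auto simp flip: distrib_left)

lemma pZb_mult: "x \<in> pZb \<Longrightarrow> y \<in> Zb \<Longrightarrow> x * y \<in> pZb"
  unfolding pZb_def by (auto simp: mult.assoc)

lemma pZb_uminus: "x \<in> pZb \<Longrightarrow> - x \<in> pZb"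
  using pZb_mult[of x "-1"] by simp

lemma Zb_frobenius_add:
  assumes "x \<in> Zb" "y \<in> Zb"
  shows "(x + y) ^ (d ^ k) - (x ^ (d ^ k) + y ^ (d ^ k)) \<in> pZb"
proof -
  obtain w where "w \<in> Zb"
    "(x + y) ^ (p ^ (e * k)) = x ^ (p ^ (e * k)) + y ^ (p ^ (e * k)) + of_nat p * x * y * w"
    using Zb.freshmans_dream[OF prime_p assms] by blast
  then have "(x + y) ^ (d ^ k) - (x ^ (d ^ k) + y ^ (d ^ k)) = of_nat p * (x * y * w)" "x * y * w \<in> Zb"
    using assms by (auto simp: d power_mult)
  then show ?thesis by (metis pZbI)
qed

lemma orbit_mem_Zb: "(f ^^ k) 0 \<in> Zb"
  using b_mem_Zb by (induction k) (auto simp: f)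

text \<open>Modulo \<open>p\<close>, \<open>f\<close> is the Frobenius endomorphism \<open>\<phi>(x) = x\<^sup>d\<close> followed by the translation by \<open>b\<close>,
  so \<open>f\<^sup>k(0) = b + \<phi>(b) + \<dots> + \<phi>\<^sup>k\<^sup>-\<^sup>1(b)\<close>.\<close>

lemma orbit_step: "(f ^^ Suc k) 0 - ((f ^^ k) 0 + b ^ (d ^ k)) \<in> pZb"
proof (induction k)
  case 0
  show ?case using pZbI[of 0] f_zero by simp
next
  case (Suc k)
  \<comment> \<open>Taking \<open>d\<close>-th powers preserves the congruence between
    \<open>c'\<close> and \<open>c + a\<close>, and additivity of Frobenius splits the power of
    \<open>c + a\<close>. Adding \<open>b\<close> gives the next congruence.\<close>
  define c where "c = (f ^^ k) 0"
  define c' where "c' = (f ^^ Suc k) 0"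
  define a where "a = b ^ (d ^ k)"
  have mem: "c \<in> Zb" "c' \<in> Zb" "a \<in> Zb"
    using orbit_mem_Zb orbit_mem_Zb[of "Suc k"] b_mem_Zb by (auto simp: c_def c'_def a_def)
  have diff: "c' - (c + a) \<in> pZb" using Suc by (simp add: c_def c'_def a_def)
  obtain w where w: "w \<in> Zb" "c' ^ d - (c + a) ^ d = (c' - (c + a)) * w"
    using Zb.diff_power_factor[of c' "c + a" d] mem by auto
  then have "c' ^ d - (c + a) ^ d \<in> pZb" using diff pZb_mult by simp
  moreover have "(c + a) ^ d - (c ^ d + a ^ d) \<in> pZb"
    using Zb_frobenius_add[of c a 1] mem by simp
  ultimately have "(c' ^ d - (c + a) ^ d) + ((c + a) ^ d - (c ^ d + a ^ d)) \<in> pZb" by (rule pZb_add)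
  moreover have "c' = c ^ d + b" "(f ^^ Suc (Suc k)) 0 = c' ^ d + b" "b ^ (d ^ Suc k) = a ^ d"
    by (simp_all add: c_def c'_def a_def f power_mult[symmetric] mult.commute)
  ultimately show ?case unfolding c'_def[symmetric] by simp
qed

text \<open>For a period \<open>n\<close> of 0, \<open>orbit_step\<close> compares \<open>b\<close>
  with \<open>b ^ (d ^ n)\<close>. The elements fixed modulo \<open>p\<close> by a power of
  Frobenius form a subring, which thus contains all of \<open>Zb\<close>.\<close>

lemma ex_frobenius_identity: "\<exists>n>0. \<forall>x\<in>Zb. x ^ (d ^ n) - x \<in> pZb"
proof -
  obtain n where n: "n \<ge> 1" "(f ^^ n) 0 = 0"
    using zero_periodic by (auto simp: periodic_point_def)
  let ?q = "d ^ n"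
  have "b - b ^ ?q \<in> pZb"
    using orbit_step[of n] n f_zero by simp
  then have b: "b ^ ?q - b \<in> pZb" using pZb_uminus by fastforce
  have "x ^ ?q - x \<in> pZb" if "x \<in> Zb" for x
    using that unfolding Zb_def
  proof (induction rule: generate_ring.induct)
    case one
    show ?case using pZbI[of 0] by simp
  next
    case (incl h)
    then show ?case using b by simp
  next
    case (a_inv h)
    then have h: "h \<in> Zb" "h ^ ?q - h \<in> pZb" by (simp_all add: Zb_def)
    \<comment> \<open>Additivity applied to \<open>h + (- h)\<close> treats even and odd
      \<open>p\<close> alike.\<close>
    have "d > 0" using d_ge_2 by simp
    then have "- (h ^ ?q + (- h) ^ ?q) \<in> pZb"
      using Zb_frobenius_add[of h "- h" n] h(1) by (simp add: power_0_left)
    from pZb_add[OF h(2) this] show ?case using pZb_uminus by fastforce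
  next
    case (eng_add h1 h2)
    then have h: "h1 \<in> Zb" "h2 \<in> Zb" "h1 ^ ?q - h1 \<in> pZb" "h2 ^ ?q - h2 \<in> pZb" by (simp_all add: Zb_def)
    from pZb_add[OF Zb_frobenius_add[of h1 h2 n, OF h(1,2)] pZb_add[OF h(3,4)]]
    show ?case by (simp add: algebra_simps)
  next
    case (eng_mult h1 h2)
    then have h: "h1 \<in> Zb" "h2 \<in> Zb" "h1 ^ ?q - h1 \<in> pZb" "h2 ^ ?q - h2 \<in> pZb" by (simp_all add: Zb_def)
    have "(h1 ^ ?q - h1) * h2 ^ ?q + (h2 ^ ?q - h2) * h1 \<in> pZb"
      using h by (intro pZb_add pZb_mult) auto
    then show ?case by (simp add: power_mult_distrib algebra_simps)
  qed
  then show ?thesis using n by (intro exI[of _ n]) auto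
qed

text \<open>This is the unramified condition: \<open>x ^ (d ^ n) - x\<close> is a multiple of
  \<open>p\<close> and equals \<open>x\<close> times \<open>x ^ (d ^ n - 1) - 1\<close>, a unit of
  \<open>V\<close> when \<open>x\<close> is in \<open>M\<close>.\<close>

lemma Zb_divisible_by_p:
  assumes "x \<in> Zb" "x \<in> M"
  shows "\<exists>k y. k \<in> V \<and> k \<notin> M \<and> y \<in> Zb \<and> x * k = of_nat p * y"
proof -
  obtain n where n: "n > 0" "x ^ (d ^ n) - x \<in> pZb"
    using ex_frobenius_identity assms(1) by blast
  then obtain y where y: "y \<in> Zb" "x ^ (d ^ n) - x = of_nat p * y" by (auto simp: pZb_def)
  define k where "k = x ^ (d ^ n - 1) - 1"
  have "1 < d ^ n" using d_ge_2 n by (intro one_less_power) auto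
  then have "d ^ n = Suc (d ^ n - 1)" "x ^ (d ^ n - 1) \<in> M"
    using assms(2) by (simp_all add: power_mem_M)
  then have "x ^ (d ^ n) = x * x ^ (d ^ n - 1)"
    by (metis power_Suc)
  then have "x * k = of_nat p * y" "k \<in> V"
    using y(2) \<open>x ^ (d ^ n - 1) \<in> M\<close> by (auto simp: k_def algebra_simps)
  moreover have "k \<notin> M"
    using unit_add[of "-1" "x ^ (d ^ n - 1)"] \<open>x ^ (d ^ n - 1) \<in> M\<close> M_uminus[of "-1"]
    by (auto simp: k_def)
  ultimately show ?thesis using y(1) by blast
qed

text \<open>Factors \<open>p\<close> are split off as long as the remaining \<open>y\<close> is in
  \<open>M\<close>. Collecting the units on the side of \<open>x\<close> keeps \<open>y\<close> in
  \<open>Zb\<close>, so the division can be repeated; it must stop because \<open>x\<close> is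
  algebraic.\<close>

lemma Zb_valuation:
  assumes x: "x \<in> Zb" "x \<noteq> 0"
  shows "\<exists>j u. u \<in> V \<and> u \<notin> M \<and> x = of_nat p ^ j * u"
proof (rule ccontr)
  assume no: "\<not> ?thesis"
  have "\<exists>k y. k \<in> V \<and> k \<notin> M \<and> y \<in> Zb \<and> x * k = of_nat p ^ j * y" for j
  proof (induction j)
    case 0
    show ?case using x by (intro exI[of _ 1] exI[of _ x]) auto
  next
    case (Suc j)
    then obtain k y where ky: "k \<in> V" "k \<notin> M" "y \<in> Zb" "x * k = of_nat p ^ j * y" by blast
    have "y \<in> M"
    proof (rule ccontr)
      assume y: "y \<notin> M"
      note k = unit_inverse[OF ky(1,2)] unit_nonzero[OF ky(1,2)]
      have "y * inverse k \<notin> M"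
        using y ky k M_mult[of "y * inverse k" k] by (auto simp: mult.assoc)
      moreover have "y * inverse k \<in> V" using ky k Zb_subset_V by auto
      moreover have "x = of_nat p ^ j * (y * inverse k)" using ky(4) k by (simp add: field_simps)
      ultimately show False using no by blast
    qed
    then obtain k' y' where ky': "k' \<in> V" "k' \<notin> M" "y' \<in> Zb" "y * k' = of_nat p * y'"
      using Zb_divisible_by_p ky by blast
    have "x * (k * k') = of_nat p ^ Suc j * y'"
      using ky(4) ky'(4) by (metis mult.assoc mult.left_commute power_Suc2)
    moreover have "k * k' \<in> V" "k * k' \<notin> M" using ky ky' M_prime by auto
    ultimately show ?case using ky'(3) by blast
  qed
  then have "\<exists>s\<in>V. x = of_nat p ^ j * s" for j
  proof -
    obtain k y where ky: "k \<in> V" "k \<notin> M" "y \<in> Zb" "x * k = of_nat p ^ j * y"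
      using \<open>\<And>j. \<exists>k y. k \<in> V \<and> k \<notin> M \<and> y \<in> Zb \<and> x * k = of_nat p ^ j * y\<close> by blast
    then have "x = of_nat p ^ j * (y * inverse k)"
      using unit_nonzero[of k] by (simp add: field_simps)
    moreover have "y * inverse k \<in> V"
      using ky unit_inverse[of k] Zb_subset_V by blast
    ultimately show ?thesis by blast
  qed
  then show False
    using algebraic_not_infinitely_divisible[of x] algebraic_K Zb_subset_K x by blast
qed

lemma unit_mult: "u \<in> V - M \<Longrightarrow> v \<in> V - M \<Longrightarrow> u * v \<in> V - M"
  using M_prime by auto

lemma unit_inverse': "u \<in> V - M \<Longrightarrow> inverse u \<in> V - M"
  using unit_inverse[of u] unit_nonzero[of u] M_mult[of "inverse u" u] by auto

lemma K_valuation: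
  assumes "x \<in> K" "x \<noteq> 0"
  shows "\<exists>j. \<exists>u\<in>V - M. x = of_nat p powi j * u"
proof -
  obtain y z where yz: "y \<in> Zb" "z \<in> Zb" "z \<noteq> 0" "x = y / z"
    using K_fraction[OF assms(1)] by blast
  then have "y \<noteq> 0" using assms(2) by auto
  obtain i u where u: "u \<in> V - M" "y = of_nat p ^ i * u"
    using Zb_valuation[OF yz(1) \<open>y \<noteq> 0\<close>] by blast
  obtain j v where v: "v \<in> V - M" "z = of_nat p ^ j * v"
    using Zb_valuation[OF yz(2,3)] by blast
  have "x = of_nat p powi (int i - int j) * (u * inverse v)"
    using yz(4) u v p_nonzero by (simp add: power_int_diff field_simps)
  then show ?thesis using unit_mult[OF u(1) unit_inverse'[OF v(1)]] by blast
qed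

end

section \<open>Places and residue degrees\<close>

lemma powr_le_one_iff: "0 \<le> x \<Longrightarrow> 0 < s \<Longrightarrow> x powr s \<le> 1 \<longleftrightarrow> x \<le> (1::real)"
  using powr_mono2[of s x 1] powr_less_mono2[of s 1 x] by (cases "x \<le> 1") (auto simp: not_le)

lemma powr_less_one_iff: "0 \<le> x \<Longrightarrow> 0 < s \<Longrightarrow> x powr s < 1 \<longleftrightarrow> x < (1::real)"
  using powr_less_mono2[of s x 1] powr_mono2[of s 1 x] by (cases "x < 1") (auto simp: not_less)

lemma placesE:
  assumes "v \<in> places K"
  obtains a where "a \<in> absolute_values K" "v = absolute_value_equiv K `` {a}"
  using assms by (auto simp: places_def elim: quotientE)

text \<open>Equivalent absolute values differ by a positive exponent, which preserves comparison
  with 1, so one representative determines the valuation ring and its ideal.\<close>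

lemma place_class:
  assumes "a \<in> absolute_values K"
  defines "v \<equiv> absolute_value_equiv K `` {a}"
  shows "v \<in> places K" "a \<in> v"
    "{x \<in> K. \<forall>a'\<in>v. a' x \<le> 1} = {x \<in> K. a x \<le> 1}"
    "{x \<in> K. \<forall>a'\<in>v. a' x < 1} = {x \<in> K. a x < 1}"
proof -
  have nonneg: "a x \<ge> 0" if "x \<in> K" for x
    using assms(1) that by (simp add: absolute_values_def absolute_value_on_def)
  show "v \<in> places K"
    unfolding v_def places_def using assms(1) by (rule quotientI)
  show a: "a \<in> v"
    unfolding v_def absolute_value_equiv_def using assms(1) nonneg
    by (auto intro!: exI[of _ 1])
  have pow: "\<exists>s>0. \<forall>x\<in>K. a' x = a x powr s" if "a' \<in> v" for a'
    using that by (auto simp: v_def absolute_value_equiv_def)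
  show "{x \<in> K. \<forall>a'\<in>v. a' x \<le> 1} = {x \<in> K. a x \<le> 1}"
    using a pow nonneg powr_le_one_iff by fastforce
  show "{x \<in> K. \<forall>a'\<in>v. a' x < 1} = {x \<in> K. a x < 1}"
    using a pow nonneg powr_less_one_iff by fastforce
qed

text \<open>The ultrametric inequality closes the unit ball under addition. Multiplicativity gives
  the alternative between \<open>x\<close> and its inverse and shows that the non-units are the
  elements of value below 1.\<close>

lemma absolute_value_p_valuation_subring:
  assumes K: "subfield K complex_field" and a: "absolute_value_on K a" "nonarchimedean_on K a"
    and p: "Factorial_Ring.prime p" "a (of_nat p) < 1"
  shows "p_valuation_subring {x \<in> K. a x \<le> 1} K p"
    and "valuation_subring.M {x \<in> K. a x \<le> 1} = {x \<in> K. a x < 1}"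
proof -
  interpret K: complex_subring K
    using K unfolding subfield_complex_iff by (intro complex_subring.intro) blast
  have inv_K: "inverse x \<in> K" if "x \<in> K" for x
    using K that unfolding subfield_complex_iff by blast
  have nonneg: "a x \<ge> 0" and zero: "a x = 0 \<longleftrightarrow> x = 0" if "x \<in> K" for x
    using a(1) that by (auto simp: absolute_value_on_def)
  have mult: "a (x * y) = a x * a y" and ultra: "a (x + y) \<le> max (a x) (a y)" if "x \<in> K" "y \<in> K" for x y
    using a that by (auto simp: absolute_value_on_def nonarchimedean_on_def)
  have one: "a 1 = 1" using mult[of 1 1] zero[of 1] by auto
  have "a (-1) * a (-1) = 1" using mult[of "-1" "-1"] one by simp
  then have neg_one: "a (-1) = 1"
    using nonneg[of "-1"] square_eq_1_iff[of "a (-1)"] by auto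
  have neg: "a (- x) = a x" if "x \<in> K" for x
    using mult[of "-1" x] that neg_one by simp
  have inv: "a x * a (inverse x) = 1" if "x \<in> K" "x \<noteq> 0" for x
    using mult[of x "inverse x"] that inv_K one by simp
  let ?V = "{x \<in> K. a x \<le> 1}"
  interpret V: valuation_subring ?V K
  proof (intro valuation_subring.intro valuation_subring_axioms.intro complex_subring.intro)
    show "subring ?V complex_field"
      unfolding subring_complex_iff
    proof (intro conjI ballI)
      fix x y assume "x \<in> ?V" "y \<in> ?V"
      then show "x + y \<in> ?V" "x * y \<in> ?V"
        using ultra[of x y] mult[of x y] nonneg by (auto intro: mult_le_one)
    qed (auto simp: one neg)
    show "x \<in> ?V \<or> inverse x \<in> ?V" if "x \<in> K" for x
    proof (cases "x = 0")
      case True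
      then show ?thesis using zero[of 0] by auto
    next
      case False
      have "a x \<le> 1 \<or> a (inverse x) \<le> 1"
      proof (rule ccontr)
        assume "\<not> ?thesis"
        then have "1 < a x * a (inverse x)" by (intro less_1_mult) auto
        then show False using inv[OF that False] by simp
      qed
      then show ?thesis using that inv_K by auto
    qed
  qed (use K in auto)
  show M: "V.M = {x \<in> K. a x < 1}"
  proof (rule Set.set_eqI)
    fix x
    show "x \<in> V.M \<longleftrightarrow> x \<in> {x \<in> K. a x < 1}"
    proof (cases "x \<in> K \<and> x \<noteq> 0")
      case True
      then have "a x > 0" using nonneg[of x] zero[of x] by auto
      moreover have "a (inverse x) = 1 / a x"
        using inv[of x] True \<open>a x > 0\<close> by (simp add: field_simps)
      ultimately have "a (inverse x) \<le> 1 \<longleftrightarrow> 1 \<le> a x" by simp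
      then show ?thesis using True inv_K[of x] by (auto simp: V.M_def)
    qed (use zero[of 0] in \<open>auto simp: V.M_def\<close>)
  qed
  show "p_valuation_subring ?V K p"
    by (intro p_valuation_subring.intro V.valuation_subring_axioms p_valuation_subring_axioms.intro p)
       (use p(2) in \<open>simp add: M\<close>)
qed

lemma residue_degree_place:
  assumes K: "subfield K complex_field" and a: "a \<in> absolute_values K"
    and above: "place_above K p (absolute_value_equiv K `` {a})" and p: "Factorial_Ring.prime p"
    and dim: "CF.dimension N \<rat> K"
  defines "V \<equiv> {x \<in> K. a x \<le> 1}" and "n \<equiv> residue_degree K (absolute_value_equiv K `` {a})"
  shows "1 \<le> n" "n \<le> N" "finite (carrier (valuation_subring.F V))"
    "card (carrier (valuation_subring.F V)) = p ^ n"
proof -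
  let ?v = "absolute_value_equiv K `` {a}"
  note cls = place_class[OF a]
  have na: "nonarchimedean_on K a" "a (of_nat p) < 1"
    using above cls(2) by (auto simp: place_above_def)
  have av: "absolute_value_on K a" using a by (simp add: absolute_values_def)
  interpret p_valuation_subring V K p
    unfolding V_def by (rule absolute_value_p_valuation_subring[OF K av na(1) p na(2)])
  have "valuation_ring K ?v = Vr"
    unfolding valuation_ring_def cls(3) by (fold V_def) (simp add: Vr_def)
  moreover have "valuation_ideal K ?v = M"
    unfolding valuation_ideal_def cls(4) V_def
    by (rule absolute_value_p_valuation_subring(2)[OF K av na(1) p na(2), symmetric])
  ultimately have n: "n = ring.dim F (generate_field F {}) (carrier F)"
    by (simp add: n_def residue_degree_def residue_field_def F_def)
  show "1 \<le> n" "n \<le> N" "finite (carrier F)" "card (carrier F) = p ^ n"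
    using residue_dim[OF dim] unfolding n by blast+
qed

context valuation_subring
begin

text \<open>The two residue fields consist of cosets of different ideals, so they are matched by
  intersecting cosets with \<open>K\<close>. Cardinalities suffice, as the residue degree is read
  off from the order.\<close>

lemma restrict:
  assumes K: "subfield K complex_field" "K \<subseteq> E"
  shows "valuation_subring (V \<inter> K) K"
    and "card (carrier (valuation_subring.F (V \<inter> K))) = card (resid K)"
proof -
  interpret K: complex_subring K
    using K unfolding subfield_complex_iff by (intro complex_subring.intro) blast
  have inv_K: "inverse x \<in> K" if "x \<in> K" for x
    using K that unfolding subfield_complex_iff by blast
  interpret W: valuation_subring "V \<inter> K" K
    by (intro valuation_subring.intro valuation_subring_axioms.intro complex_subring.intro
        CF.subring_inter subring K.subring)
       (use K total inv_K in auto)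
  show "valuation_subring (V \<inter> K) K" ..
  have M: "W.M = M \<inter> K"
    using inv_K by (auto simp: W.M_def M_def)
  have coset: "\<pi> x \<inter> K = W.\<pi> x" if "x \<in> K" for x
  proof
    show "\<pi> x \<inter> K \<subseteq> W.\<pi> x"
    proof
      fix y assume "y \<in> \<pi> x \<inter> K"
      then obtain m where "m \<in> M" "y = m + x" "y \<in> K" by (auto simp: \<pi>_eq)
      moreover from this that have "m \<in> K" using K.diff_mem[of y x] by simp
      ultimately show "y \<in> W.\<pi> x" by (auto simp: W.\<pi>_eq M)
    qed
    show "W.\<pi> x \<subseteq> \<pi> x \<inter> K" using that by (auto simp: W.\<pi>_eq \<pi>_eq M)
  qed
  have "bij_betw (\<lambda>C. C \<inter> K) (resid K) (carrier W.F)"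
    unfolding bij_betw_def
  proof
    show "inj_on (\<lambda>C. C \<inter> K) (resid K)"
    proof (rule inj_onI)
      fix C D assume "C \<in> resid K" "D \<in> resid K" and eq: "C \<inter> K = D \<inter> K"
      then obtain x y where xy: "x \<in> K" "y \<in> K" "C = \<pi> x" "D = \<pi> y" by (auto simp: resid_def)
      then have "W.\<pi> x = W.\<pi> y" using eq coset by simp
      then show "C = D" using xy by (simp add: W.\<pi>_eq_iff \<pi>_eq_iff M)
    qed
    show "(\<lambda>C. C \<inter> K) ` resid K = carrier W.F"
      unfolding resid_def W.F_simps image_image using coset by (intro image_cong) auto
  qed
  then show "card (carrier W.F) = card (resid K)" by (simp add: bij_betw_same_card)
qed

end

section \<open>The place of \<open>K\<close> induced by \<open>V\<close>\<close>

context unicritical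
begin

lemma K_inverse: "x \<in> K \<Longrightarrow> inverse x \<in> K"
  using subfield_K unfolding subfield_complex_iff by blast

lemma valuation_unique:
  assumes "u \<in> V - M" "v \<in> V - M" "of_nat p powi i * u = of_nat p powi j * v"
  shows "i = j"
proof -
  have *: False if "u \<in> V - M" "v \<in> V - M" "of_nat p powi i * u = of_nat p powi j * v" "i < j" for u v i j
  proof -
    have "u = of_nat p powi (j - i) * v"
      using that(3) p_nonzero by (simp add: power_int_diff field_simps)
    also have "\<dots> = of_nat p ^ nat (j - i) * v"
      using that(4) by (simp add: power_int_def)
    also have "\<dots> \<in> M"
      using that by (intro M_mult power_mem_M p_mem_M) auto
    finally show False using that(1) by simp
  qed
  show ?thesis
    using *[OF assms] *[OF assms(2,1) assms(3)[symmetric]] by (cases i j rule: linorder_cases) auto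
qed

text \<open>The normalised valuation with uniformizer \<open>p\<close>. For nonzero elements of
  \<open>K\<close> the exponent exists by \<open>K_valuation\<close> and is unique by
  \<open>valuation_unique\<close>.\<close>

definition val :: "complex \<Rightarrow> int" where
  "val x = (THE j. \<exists>u\<in>V - M. x = of_nat p powi j * u)"

lemma val_eqI: "x = of_nat p powi j * u \<Longrightarrow> u \<in> V - M \<Longrightarrow> val x = j"
  unfolding val_def using valuation_unique by (intro the_equality) blast+

lemma valE:
  assumes "x \<in> K" "x \<noteq> 0"
  obtains u where "u \<in> V - M" "x = of_nat p powi val x * u"
  using K_valuation[OF assms] val_eqI by metis

lemma val_mem_iff:
  assumes "x \<in> K" "x \<noteq> 0"
  shows "x \<in> V \<longleftrightarrow> 0 \<le> val x" and "x \<in> M \<longleftrightarrow> 0 < val x"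
proof -
  define j where "j = val x"
  obtain u where u: "u \<in> V - M" "x = of_nat p powi j * u"
    using assms unfolding j_def by (rule valE)
  have pos: "x \<in> V" if "0 \<le> j"
    using that u by (auto simp: power_int_def)
  have pos': "x \<in> M" if "0 < j"
    using that u by (auto simp: power_int_def intro!: M_mult power_mem_M p_mem_M)
  have zero: "x \<notin> M" if "j = 0" using that u by simp
  have neg: "x \<notin> V" if "j < 0"
  proof
    assume "x \<in> V"
    have "u = of_nat p powi (- j) * x"
      using p_nonzero by (simp add: u(2) power_int_minus)
    also have "\<dots> = of_nat p ^ nat (- j) * x" using that by (simp add: power_int_def)
    also have "\<dots> \<in> M" using that \<open>x \<in> V\<close> by (intro M_mult power_mem_M p_mem_M) auto
    finally show False using u by simp
  qed
  show "x \<in> V \<longleftrightarrow> 0 \<le> val x" unfolding j_def[symmetric] using pos neg by force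
  show "x \<in> M \<longleftrightarrow> 0 < val x" unfolding j_def[symmetric]
    using pos' zero neg M_mem[of x] by (cases j "0::int" rule: linorder_cases) auto
qed

lemma val_mult:
  assumes "x \<in> K" "x \<noteq> 0" "y \<in> K" "y \<noteq> 0"
  shows "val (x * y) = val x + val y"
proof -
  obtain u where u: "u \<in> V - M" "x = of_nat p powi val x * u" using assms(1,2) by (rule valE)
  obtain v where v: "v \<in> V - M" "y = of_nat p powi val y * v" using assms(3,4) by (rule valE)
  have "x * y = of_nat p powi (val x + val y) * (u * v)"
    using p_nonzero by (subst u(2), subst v(2)) (simp add: power_int_add)
  then show ?thesis using unit_mult[OF u(1) v(1)] by (rule val_eqI)
qed

text \<open>Presents \<open>V\<close> restricted to \<open>K\<close> as an absolute value, the form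
  in which places are defined. Zero is treated apart because it has no valuation.\<close>

definition absK :: "complex \<Rightarrow> real" where
  "absK x = (if x = 0 then 0 else real p powi (- val x))"

lemma p_gt_1: "real p > 1"
  using prime_gt_1_nat[OF prime_p] by simp

lemma absK_mem_iff:
  assumes "x \<in> K"
  shows "absK x \<le> 1 \<longleftrightarrow> x \<in> V" and "absK x < 1 \<longleftrightarrow> x \<in> M"
proof -
  consider "x = 0" | "x \<noteq> 0" "val x < 0" | "x \<noteq> 0" "val x = 0" | "x \<noteq> 0" "val x > 0"
    by linarith
  then have "(absK x \<le> 1 \<longleftrightarrow> x \<in> V) \<and> (absK x < 1 \<longleftrightarrow> x \<in> M)"
  proof cases
    case 1
    then show ?thesis by (simp add: absK_def)
  next
    case 2
    then have "absK x > 1"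
      using power_int_strict_increasing[of 0 "- val x" "real p"] p_gt_1 by (simp add: absK_def)
    then show ?thesis using 2 val_mem_iff[OF assms] by simp
  next
    case 3
    then show ?thesis using val_mem_iff[OF assms] by (simp add: absK_def)
  next
    case 4
    then have "absK x < 1"
      using power_int_strict_increasing[of "- val x" 0 "real p"] p_gt_1 by (simp add: absK_def)
    then show ?thesis using 4 val_mem_iff[OF assms] by simp
  qed
  then show "absK x \<le> 1 \<longleftrightarrow> x \<in> V" "absK x < 1 \<longleftrightarrow> x \<in> M" by blast+
qed

lemma absK_mult:
  assumes "x \<in> K" "y \<in> K" shows "absK (x * y) = absK x * absK y"
  using assms p_gt_1 by (auto simp: absK_def val_mult power_int_diff power_int_minus divide_inverse)

lemma absK_pos: "x \<noteq> 0 \<Longrightarrow> absK x > 0"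
  using p_gt_1 by (simp add: absK_def)

lemma absK_ultrametric:
  assumes "x \<in> K" "y \<in> K" shows "absK (x + y) \<le> max (absK x) (absK y)"
proof -
  have *: "absK (x + y) \<le> absK y" if "x \<in> K" "y \<in> K" "x / y \<in> V" "y \<noteq> 0" for x y
  proof -
    define z where "z = (x + y) / y"
    have "z = x / y + 1" using that by (simp add: z_def field_simps)
    then have "z \<in> V" using that by auto
    moreover have "z \<in> K" unfolding z_def divide_inverse using that K_inverse by auto
    ultimately have "absK z \<le> 1" using absK_mem_iff by blast
    then have "absK (z * y) \<le> absK y"
      using absK_mult[OF \<open>z \<in> K\<close> that(2)] absK_pos[OF that(4)] by simp
    then show ?thesis using that(4) by (simp add: z_def)
  qed
  show ?thesis
  proof (cases "x = 0 \<or> y = 0")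
    case True
    then show ?thesis by auto
  next
    case False
    then show ?thesis
      using total[of "x / y"] *[OF assms] *[OF assms(2,1)] by (auto simp: add.commute)
  qed
qed

lemma absK_absolute_value: "absK \<in> absolute_values K"
proof -
  have "absK (x + y) \<le> absK x + absK y" if "x \<in> K" "y \<in> K" for x y
  proof -
    have "absK x \<ge> 0" "absK y \<ge> 0"
      using absK_pos[of x] absK_pos[of y] by (auto simp: absK_def)
    then show ?thesis using absK_ultrametric[OF that] by linarith
  qed
  moreover have "absK x \<ge> 0 \<and> (absK x = 0 \<longleftrightarrow> x = 0)" for x
    using absK_pos[of x] by (cases "x = 0") (simp add: absK_def, force)
  moreover have "absK (of_nat p) < 1"
    using absK_mem_iff(2)[of "of_nat p"] p_mem_M by simp
  ultimately show ?thesis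
    using p_nonzero prime_gt_0_nat[OF prime_p] unfolding absolute_values_def absolute_value_on_def nontrivial_on_def
    by (auto simp: absK_mult intro!: bexI[of _ "of_nat p"])
qed

definition vK :: "(complex \<Rightarrow> real) set" where
  "vK = absolute_value_equiv K `` {absK}"

lemma vK_place: "vK \<in> places K"
  unfolding vK_def by (rule place_class(1)[OF absK_absolute_value])

lemma vK_above: "place_above K p vK"
proof -
  have "of_nat p \<in> {x \<in> K. \<forall>a\<in>vK. a x < 1}"
    unfolding vK_def place_class(4)[OF absK_absolute_value]
    using absK_mem_iff(2)[of "of_nat p"] p_mem_M by simp
  moreover have "nonarchimedean_on K a" if a: "a \<in> vK" for a
  proof -
    obtain s where s: "s > 0" "\<And>x. x \<in> K \<Longrightarrow> a x = absK x powr s"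
      using a by (auto simp: vK_def absolute_value_equiv_def)
    have "a (x + y) \<le> max (a x) (a y)" if "x \<in> K" "y \<in> K" for x y
    proof -
      have nonneg: "absK z \<ge> 0" for z using absK_pos[of z] by (auto simp: absK_def)
      have "absK (x + y) powr s \<le> max (absK x) (absK y) powr s"
        using s absK_ultrametric[OF that] nonneg by (intro powr_mono2) auto
      also have "\<dots> \<le> max (absK x powr s) (absK y powr s)"
        by (cases "absK x \<le> absK y") (auto simp: max_def)
      finally show ?thesis using s that by simp
    qed
    then show ?thesis by (simp add: nonarchimedean_on_def)
  qed
  ultimately show ?thesis by (auto simp: place_above_def)
qed

lemma card_resid_K:
  assumes "CF.dimension N \<rat> K"
  shows "finite (resid K)" "card (resid K) = p ^ residue_degree K vK" "residue_degree K vK \<ge> 1"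
proof -
  have "{x \<in> K. absK x \<le> 1} = V \<inter> K" using absK_mem_iff by auto
  note deg = residue_degree_place[OF subfield_K absK_absolute_value vK_above[unfolded vK_def] prime_p assms,
      folded vK_def, unfolded this]
  show card: "card (resid K) = p ^ residue_degree K vK"
    using deg(4) restrict(2)[OF subfield_K] by simp
  show "finite (resid K)"
    \<comment> \<open>An infinite set has \<open>card\<close> 0, so a positive cardinality proves
      finiteness.\<close>
    by (rule card_ge_0_finite) (simp add: card prime_gt_0_nat[OF prime_p])
  show "residue_degree K vK \<ge> 1" by (rule deg(1))
qed

text \<open>Divisibility gives the inequality once \<open>Lcm S\<close> is nonzero. It would be 0
  for an infinite set or one containing 0, and \<open>S \<subseteq> {1..N}\<close> excludes
  both.\<close>

lemma residue_degree_le_Lcm: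
  assumes "CF.dimension N \<rat> K"
  defines "S \<equiv> {residue_degree K v | v. v \<in> places K \<and> place_above K p v}"
  shows "residue_degree K vK \<le> Lcm S"
proof -
  have "S \<subseteq> {1..N}"
  proof
    fix n assume "n \<in> S"
    then obtain v where v: "n = residue_degree K v" "v \<in> places K" "place_above K p v"
      by (auto simp: S_def)
    obtain a where a: "a \<in> absolute_values K" "v = absolute_value_equiv K `` {a}"
      using v(2) by (rule placesE)
    show "n \<in> {1..N}"
      using residue_degree_place(1,2)[OF subfield_K a(1) _ prime_p assms(1)] v a(2) by simp
  qed
  then have "finite S" "0 \<notin> S" by (auto intro: finite_subset)
  then have "Lcm S \<noteq> 0" by (simp add: Lcm_0_iff_nat)
  moreover have "residue_degree K vK dvd Lcm S"
    using vK_place vK_above by (intro dvd_Lcm) (auto simp: S_def)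
  ultimately show ?thesis by (simp add: dvd_imp_le)
qed

end

section \<open>Bounds on period and preperiod\<close>

lemma CF_combine_eq_sum:
  "length Ks = length Us \<Longrightarrow> CF.combine Ks Us = (\<Sum>i<length Us. Ks ! i * Us ! i)"
proof (induction Us arbitrary: Ks)
  case (Cons u Us)
  then obtain k Ls where "Ks = k # Ls" "length Ls = length Us" by (cases Ks) auto
  then show ?case using Cons.IH[of Ls] by (simp add: sum.lessThan_Suc_shift del: sum.lessThan_Suc)
qed simp

text \<open>If \<open>\<zeta> ^ p = 1\<close>, the powers of \<open>\<zeta>\<close> below
  \<open>p\<close> sum to 0 while each is congruent to 1 modulo \<open>\<zeta> - 1\<close>, so
  \<open>p\<close> is congruent to 0. Otherwise \<open>\<zeta> - 1\<close> divides
  \<open>\<zeta> ^ p - 1\<close> and induction applies.\<close>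

lemma (in complex_subring) root_of_unity_minus_one_dvd_prime:
  assumes p: "Factorial_Ring.prime p" and "\<zeta> \<in> R" "\<zeta> \<noteq> 1" "\<zeta> ^ (p ^ e) = 1"
  shows "\<exists>w\<in>R. of_nat p = (\<zeta> - 1) * w"
  using assms(2-)
proof (induction e arbitrary: \<zeta>)
  case (Suc e)
  show ?case
  proof (cases "\<zeta> ^ p = 1")
    case True
    have "(\<zeta> - 1) * (\<Sum>i<p. \<zeta> ^ i) = 0"
      using True power_diff_1_eq[of \<zeta> p] by simp
    then have geo: "(\<Sum>i<p. \<zeta> ^ i) = 0" using Suc.prems by simp
    have "\<forall>i. \<exists>w\<in>R. \<zeta> ^ i - 1 = (\<zeta> - 1) * w"
      using diff_power_factor[OF Suc.prems(1) one_mem] by simp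
    then obtain w where w: "\<And>i. w i \<in> R" "\<And>i. \<zeta> ^ i - 1 = (\<zeta> - 1) * w i" by metis
    have "of_nat p = (\<Sum>i<p. (1 :: complex))" by simp
    also have "\<dots> = (\<Sum>i<p. \<zeta> ^ i) - (\<Sum>i<p. \<zeta> ^ i - 1)"
      by (simp add: sum_subtractf)
    also have "\<dots> = (\<zeta> - 1) * (- (\<Sum>i<p. w i))"
      by (simp add: geo w(2) sum_distrib_left)
    finally show ?thesis using w(1) sum_mem[of "{..<p}" w] by blast
  next
    case False
    then obtain w where w: "w \<in> R" "of_nat p = (\<zeta> ^ p - 1) * w"
      using Suc.IH[of "\<zeta> ^ p"] Suc.prems by (auto simp: power_mult)
    obtain w' where "w' \<in> R" "\<zeta> ^ p - 1 = (\<zeta> - 1) * w'"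
      using diff_power_factor[OF Suc.prems(1) one_mem, of p] by auto
    then show ?thesis using w by (intro bexI[of _ "w' * w"]) (auto simp: mult.assoc)
  qed
qed simp

context unicritical
begin

text \<open>\<open>t\<close> is the degree of the residue field of \<open>L\<close> over that of
  \<open>K\<close>. The exponent of \<open>x\<close> is the order of the residue field of
  \<open>L\<close>.\<close>

lemma power_card_cong:
  assumes dimK: "CF.dimension N\<^sub>0 \<rat> K" and L: "subfield L complex_field" "K \<subseteq> L"
    and dimL: "CF.dimension N K L"
  shows "\<exists>t. 1 \<le> t \<and> t \<le> N \<and> (\<forall>x\<in>V \<inter> L. x ^ (p ^ (residue_degree K vK * t)) - x \<in> M)"
proof -
  interpret F: cring F by (rule F_cring)
  interpret L: complex_subring L
    using L unfolding subfield_complex_iff by (intro complex_subring.intro) blast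
  obtain t where t: "t \<le> N" "F.dimension t (resid K) (resid L)"
    using dimension_resid[OF subfield_K L _ dimL] by auto
  note card = F.card_of_dimension[OF t(2) subfield_resid[OF subfield_K] card_resid_K(1)[OF dimK]]
  have cardL: "finite (resid L)" "card (resid L) = p ^ (residue_degree K vK * t)"
    using card card_resid_K(2)[OF dimK] by (simp_all add: power_mult)
  let ?R = "F\<lparr>carrier := resid L\<rparr>"
  have "field ?R"
    using F.subfield_iff(2)[OF subfield_resid[OF L(1)]] .
  then have pow: "y [^]\<^bsub>?R\<^esub> card (resid L) = y" if "y \<in> resid L" for y
    using field.finite_field_power_card[of ?R y] cardL(1) that by simp
  have "x ^ (p ^ (residue_degree K vK * t)) - x \<in> M" if "x \<in> V \<inter> L" for x
  proof -
    have "\<pi> x [^]\<^bsub>F\<^esub> card (resid L) = \<pi> x"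
      using pow[of "\<pi> x"] that by (simp add: resid_def F.nat_pow_consistent[symmetric])
    then show ?thesis using that by (simp add: \<pi>_power \<pi>_eq_iff cardL)
  qed
  moreover have "t \<ge> 1"
  proof (rule ccontr)
    assume "\<not> 1 \<le> t"
    then have "resid L = {\<zero>\<^bsub>F\<^esub>}"
      using F.dimension_zero[OF subfield_resid[OF subfield_K]] t(2) by (cases t) auto
    moreover have "\<pi> 1 \<in> resid L" by (auto simp: resid_def)
    ultimately show False using \<pi>_eq_iff[of 1 0] by (simp add: F_simps)
  qed
  ultimately show ?thesis using t(1) by blast
qed

lemma period_divides:
  assumes L: "subring L complex_field" "b \<in> L"
    and pow: "\<And>x. x \<in> V \<inter> L \<Longrightarrow> x ^ (p ^ r) - x \<in> M"
    and z: "z \<in> L" "z \<in> V" "periodic_point f z"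
  shows "(f ^^ (p * r)) z = z"
proof -
  interpret L: complex_subring L using L(1) by (rule complex_subring.intro)
  have iter_L: "(f ^^ k) x \<in> V \<inter> L" if "x \<in> V \<inter> L" for x k
    using that L(2) by (induction k) (auto simp: f b_mem)
  have pow_iter: "x ^ (p ^ (r * k)) - x \<in> M" if x: "x \<in> V \<inter> L" for x k
  proof (induction k)
    case (Suc k)
    have "(x ^ (p ^ (r * k))) ^ (p ^ r) - x ^ (p ^ (r * k)) \<in> M"
      using x by (intro pow) auto
    from M_cong_trans[OF this Suc] show ?case
      by (simp add: power_add mult.commute flip: power_mult)
  qed simp
  define c where "c = (f ^^ r) 0"
  have c: "c \<in> V \<inter> L" using iter_L[of 0 r] by (simp add: c_def)
  have step: "(f ^^ r) x - (x + c) \<in> M" if x: "x \<in> V \<inter> L" for x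
  proof -
    \<comment> \<open>\<open>d ^ r\<close> is the \<open>e\<close>-th power of \<open>p ^ r\<close>,
      so the power map with exponent \<open>d ^ r\<close> is an iterate of the one that is trivial
      modulo \<open>M\<close>. Only the translation by \<open>c\<close> remains.\<close>
    have "d ^ r = p ^ (r * e)" by (simp add: d power_mult[symmetric] mult.commute)
    then have "x ^ (d ^ r) - x \<in> M" using pow_iter[OF x, of e] by simp
    then have "((f ^^ r) x - (x ^ (d ^ r) + c)) + (x ^ (d ^ r) - x) \<in> M"
      using iterate_cong[of x r] x by (intro M_add) (auto simp: c_def)
    then show ?thesis by (simp add: algebra_simps)
  qed
  have "(f ^^ (j * r)) z - (z + of_nat j * c) \<in> M" for j
  proof (induction j)
    case (Suc j)
    let ?y = "(f ^^ (j * r)) z"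
    have "(f ^^ r) ?y - (?y + c) \<in> M" using iter_L z by (intro step) auto
    from M_add[OF this Suc] show ?case by (simp add: funpow_add algebra_simps)
  qed simp
  from this[of p] have "(f ^^ (p * r)) z - (z + of_nat p * c) \<in> M" .
  moreover have "of_nat p * c \<in> M" using c by (intro M_mult p_mem_M) auto
  ultimately have "((f ^^ (p * r)) z - (z + of_nat p * c)) + of_nat p * c \<in> M" by (rule M_add)
  then have "(f ^^ (p * r)) z - z \<in> M" by (simp add: algebra_simps)
  then show ?thesis
    using z by (intro periodic_eqI periodic_point_iterate iterate_mem)
qed

text \<open>Since \<open>\<epsilon>\<close> divides \<open>p\<close>, the error term of
  \<open>f_diff\<close> is absorbed: \<open>\<delta> ^ d\<close> is \<open>\<epsilon>\<close> times
  an element congruent to 1 modulo \<open>M\<close>, a unit. Hence \<open>\<epsilon> ^ n\<close> may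
  be replaced by \<open>\<delta> ^ (d * n)\<close>.\<close>

lemma f_pullback_step:
  assumes "x \<in> V" "y \<in> V" "f x - f y \<in> M" "n \<ge> 1" "s \<in> V" "of_nat p = (f x - f y) ^ n * s"
  shows "x - y \<in> M" "\<exists>s\<in>V. of_nat p = (x - y) ^ (d * n) * s"
proof -
  define \<delta> where "\<delta> = x - y"
  define \<epsilon> where "\<epsilon> = f x - f y"
  obtain w where w: "w \<in> V" "\<epsilon> = \<delta> ^ d + of_nat p * \<delta> * w"
    using f_diff[OF assms(1,2)] unfolding \<delta>_def \<epsilon>_def by blast
  have \<epsilon>: "\<epsilon> \<in> M" using assms(3) by (simp add: \<epsilon>_def)
  have \<delta>V: "\<delta> \<in> V" using assms by (simp add: \<delta>_def)
  have "of_nat p * (\<delta> * w) \<in> M" using w \<delta>V by (intro M_mult p_mem_M) auto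
  then have "\<epsilon> - of_nat p * (\<delta> * w) \<in> M" using \<epsilon> by (intro M_diff)
  then have "\<delta> ^ d \<in> M" using w(2) by (simp add: mult.assoc)
  then have \<delta>: "\<delta> \<in> M" using \<delta>V M_power by blast
  then show "x - y \<in> M" by (simp add: \<delta>_def)
  have "\<epsilon> ^ n = \<epsilon> * \<epsilon> ^ (n - 1)" using assms(4) by (simp flip: power_Suc)
  then have p: "of_nat p = \<epsilon> * (\<epsilon> ^ (n - 1) * s)"
    using assms(6) by (simp add: \<epsilon>_def mult.assoc)
  define c where "c = 1 - \<epsilon> ^ (n - 1) * s * \<delta> * w"
  have "\<delta> * (\<epsilon> ^ (n - 1) * s * w) \<in> M"
    using \<delta> \<epsilon> assms(5) w by (intro M_mult) auto
  then have "1 + - (\<delta> * (\<epsilon> ^ (n - 1) * s * w)) \<notin> M"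
    by (intro unit_add) auto
  then have c: "c \<notin> M" "c \<in> V"
    using \<epsilon> \<delta>V assms(5) w by (auto simp: c_def mult_ac)
  have "\<delta> ^ d = \<epsilon> - of_nat p * \<delta> * w" using w(2) by simp
  also have "\<dots> = \<epsilon> * c" unfolding p by (simp add: c_def algebra_simps)
  finally have "\<epsilon> = \<delta> ^ d * inverse c"
    using unit_nonzero[OF c(2,1)] by simp
  then have "of_nat p = \<delta> ^ (d * n) * (inverse c ^ n * s)"
    using assms(6) unfolding \<epsilon>_def[symmetric] by (simp add: power_mult_distrib power_mult mult.assoc)
  moreover have "inverse c ^ n * s \<in> V" using unit_inverse[OF c(2,1)] assms(5) by auto
  ultimately show "\<exists>s\<in>V. of_nat p = (x - y) ^ (d * n) * s" unfolding \<delta>_def by blast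
qed

lemma f_pullback:
  assumes "x \<in> V" "y \<in> V" "(f ^^ k) x - (f ^^ k) y \<in> M"
    and "\<exists>s\<in>V. of_nat p = ((f ^^ k) x - (f ^^ k) y) * s"
  shows "x - y \<in> M \<and> (\<exists>s\<in>V. of_nat p = (x - y) ^ (d ^ k) * s)"
  using assms
proof (induction k arbitrary: x y)
  case (Suc k)
  have "f x - f y \<in> M \<and> (\<exists>s\<in>V. of_nat p = (f x - f y) ^ (d ^ k) * s)"
    using Suc.prems by (intro Suc.IH) (auto simp: funpow_swap1)
  then obtain s where "f x - f y \<in> M" "s \<in> V" "of_nat p = (f x - f y) ^ (d ^ k) * s" by blast
  moreover have "d ^ k \<ge> 1" using d_ge_2 by simp
  ultimately show ?case
    using f_pullback_step[of x y "d ^ k" s] Suc.prems by simp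
qed simp

text \<open>In a linear relation two terms would be associated, making some
  \<open>\<delta> ^ l\<close> with \<open>0 < l < D\<close> a unit times \<open>p ^ T\<close>. As
  \<open>\<delta>\<close> is in \<open>M\<close>, \<open>T\<close> is at least 1, which is too large
  because \<open>\<delta> ^ D\<close> divides \<open>p\<close>.\<close>

lemma powers_independent:
  assumes \<delta>: "\<delta> \<in> M" and s: "s \<in> V" "of_nat p = \<delta> ^ D * s"
  shows "CF.independent K (map (\<lambda>i. \<delta> ^ i) [0..<D])"
proof (rule ccontr)
  assume dep: "\<not> ?thesis"
  have "\<delta> \<noteq> 0 \<or> D = 0" using s p_nonzero by (metis mult_zero_left power_0_left)
  have "D \<noteq> 0" using dep by (intro notI) simp
  then have \<delta>0: "\<delta> \<noteq> 0" using \<open>\<delta> \<noteq> 0 \<or> D = 0\<close> by simp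
  let ?Us = "map (\<lambda>i. \<delta> ^ i) [0..<D]"
  obtain Ks where Ks: "length Ks = D" "CF.combine Ks ?Us = 0" "set Ks \<subseteq> K" "set Ks \<noteq> {0}"
    using CF.dependent_imp_non_trivial_combine[OF subfield_K _ dep] by auto
  have sum: "(\<Sum>i<D. Ks ! i * \<delta> ^ i) = 0"
    using Ks(1,2) CF_combine_eq_sum[of Ks ?Us] by simp
  have "\<exists>k\<in>set Ks. k \<noteq> 0" using Ks(1,4) \<open>D \<noteq> 0\<close> by (cases Ks) auto
  then have "\<exists>i\<in>{..<D}. Ks ! i * \<delta> ^ i \<noteq> 0"
    using \<delta>0 Ks(1) by (auto simp: in_set_conv_nth)
  then obtain i j where ij: "i < D" "j < D" "i \<noteq> j"
    "Ks ! i * \<delta> ^ i \<noteq> 0" "Ks ! j * \<delta> ^ j \<noteq> 0"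
    "Ks ! i * \<delta> ^ i / (Ks ! j * \<delta> ^ j) \<in> V" "Ks ! j * \<delta> ^ j / (Ks ! i * \<delta> ^ i) \<in> V"
    using sum_eq_0_imp_associated[of "{..<D}" "\<lambda>i. Ks ! i * \<delta> ^ i", OF _ _ _ sum] by auto
  have no: False if ij: "i < j" "j < D" "Ks ! i \<noteq> 0" "Ks ! j \<noteq> 0"
    "Ks ! i * \<delta> ^ i / (Ks ! j * \<delta> ^ j) \<in> V" "Ks ! j * \<delta> ^ j / (Ks ! i * \<delta> ^ i) \<in> V" for i j
  proof -
    define l where "l = j - i"
    define k where "k = Ks ! j / Ks ! i"
    have l: "0 < l" "l < D" "\<delta> ^ j = \<delta> ^ i * \<delta> ^ l"
      using ij by (auto simp: l_def simp flip: power_add)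
    have "Ks ! i \<in> K" "Ks ! j \<in> K" using Ks(1,3) ij by auto
    then have kK: "k \<in> K" "k \<noteq> 0"
      using ij K_inverse by (auto simp: k_def divide_inverse)
    have kl: "k * \<delta> ^ l \<in> V" "inverse (k * \<delta> ^ l) \<in> V"
      using ij(5,6) \<delta>0 ij(3,4) by (simp_all add: k_def l(3) field_simps)
    then have kl_unit: "k * \<delta> ^ l \<in> V - M"
      using \<delta>0 kK by (auto simp: M_def)
    obtain u where u: "u \<in> V - M" "k = of_nat p powi val k * u" using kK by (rule valE)
    define t where "t = - val k"
    define v where "v = k * \<delta> ^ l * inverse u"
    have v: "v \<in> V - M" unfolding v_def by (intro unit_mult kl_unit unit_inverse' u)
    have "k = of_nat p powi (- t) * u" using u(2) by (simp add: t_def)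
    then have \<delta>l: "\<delta> ^ l = of_nat p powi t * v"
      using p_nonzero unit_nonzero[of u] u(1) by (simp add: v_def power_int_minus)
    have "t > 0"
    proof (rule ccontr)
      assume t: "\<not> 0 < t"
      have "v = of_nat p powi (- t) * \<delta> ^ l" using p_nonzero by (simp add: \<delta>l power_int_minus)
      also have "\<dots> = \<delta> ^ l * of_nat p ^ nat (- t)" using t by (simp add: power_int_def)
      also have "\<dots> \<in> M" using l by (intro M_mult power_mem_M \<delta>) auto
      finally show False using v by simp
    qed
    define T where "T = nat t"
    have T: "T \<ge> 1" "\<delta> ^ l = of_nat p ^ T * v"
      using \<open>t > 0\<close> \<delta>l by (auto simp: T_def power_int_def)
    \<comment> \<open>Raising \<open>p = \<delta> ^ D * s\<close> to the power \<open>l\<close>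
      shows that \<open>p ^ (T * D)\<close> divides \<open>p ^ l\<close>, although
      \<open>T * D > l\<close>.\<close>
    have "of_nat p ^ l = (\<delta> ^ l) ^ D * s ^ l"
      by (subst s(2)) (simp add: power_mult_distrib mult.commute flip: power_mult)
    also have "\<dots> = of_nat p ^ (T * D) * (v ^ D * s ^ l)"
      unfolding T(2) by (simp add: power_mult_distrib mult.assoc flip: power_mult)
    also have "T * D = l + (T * D - l)"
      using T(1) l(2) by (metis le_add_diff_inverse less_le_trans less_imp_le mult_1 mult_le_mono1)
    finally have "of_nat p ^ l * 1 = of_nat p ^ l * (of_nat p ^ (T * D - l) * (v ^ D * s ^ l))"
      by (simp only: power_add mult.assoc mult_1_right)
    then have "1 = of_nat p ^ (T * D - l) * (v ^ D * s ^ l)"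
      using p_nonzero by simp
    also have "\<dots> \<in> M"
    proof (intro M_mult power_mem_M p_mem_M)
      show "0 < T * D - l" using T(1) l(2) by (metis less_le_trans mult_1 mult_le_mono1 zero_less_diff)
      show "v ^ D * s ^ l \<in> V" using v s by auto
    qed
    finally show False by simp
  qed
  show False
    using no[of i j] no[of j i] ij by (cases "i < j") auto
qed

lemma preper_bound:
  assumes L: "subfield L complex_field" "K \<subseteq> L" and dim: "CF.dimension N K L"
    and \<alpha>: "\<alpha> \<in> L" "preperiodic_point f \<alpha>" and m: "preper f \<alpha> = Suc k"
  shows "d ^ k \<le> N"
proof -
  interpret L: complex_subring L
    using L unfolding subfield_complex_iff by (intro complex_subring.intro) blast
  have \<alpha>V: "\<alpha> \<in> V" using \<alpha> by (simp add: preperiodic_mem)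
  have per: "periodic_point f ((f ^^ Suc k) \<alpha>)"
    using LeastI_ex[OF ex_periodic_iterate[OF \<alpha>(2)]] m by (simp add: preper_def)
  have not_per: "\<not> periodic_point f ((f ^^ k) \<alpha>)"
    using not_less_Least[of k "\<lambda>m. periodic_point f ((f ^^ m) \<alpha>)"] m by (simp add: preper_def)
  obtain n where n: "n \<ge> 1" "(f ^^ n) ((f ^^ Suc k) \<alpha>) = (f ^^ Suc k) \<alpha>"
    using per by (auto simp: periodic_point_def)
  \<comment> \<open>A multiple of the period \<open>n\<close> that is at least \<open>Suc k\<close>:
    the first property makes \<open>\<alpha>\<close> and \<open>\<beta>\<close> agree after
    \<open>Suc k\<close> steps, the second makes \<open>\<beta>\<close> periodic.\<close>
  define P where "P = n * Suc k"
  have P: "(f ^^ P) ((f ^^ Suc k) \<alpha>) = (f ^^ Suc k) \<alpha>"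
    unfolding P_def by (rule funpow_fixed_mult[OF n(2)])
  have P_ge: "P \<ge> Suc k"
    unfolding P_def using mult_le_mono1[OF n(1), of "Suc k"] by simp
  define \<beta> where "\<beta> = (f ^^ P) \<alpha>"
  have "\<beta> = (f ^^ (P - Suc k)) ((f ^^ Suc k) \<alpha>)"
    using P_ge unfolding \<beta>_def by (metis comp_apply funpow_add le_add_diff_inverse2)
  then have \<beta>_per: "periodic_point f \<beta>" using periodic_point_iterate[OF per] by simp
  have \<beta>V: "\<beta> \<in> V" using \<alpha>V by (auto simp: \<beta>_def)
  have \<beta>L: "\<beta> \<in> L"
  proof -
    have "b \<in> L" using b_mem_K L by blast
    then have "(f ^^ i) \<alpha> \<in> L" for i using \<alpha>(1) by (induction i) (auto simp: f)
    then show ?thesis by (simp add: \<beta>_def)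
  qed
  define x where "x = (f ^^ k) \<alpha>"
  define y where "y = (f ^^ k) \<beta>"
  have xy: "x \<in> V" "y \<in> V" using \<alpha>V \<beta>V by (auto simp: x_def y_def)
  have y_per: "periodic_point f y" unfolding y_def by (rule periodic_point_iterate[OF \<beta>_per])
  have "x \<noteq> y" using not_per y_per by (auto simp: x_def)
  have "(f ^^ Suc k) \<beta> = (f ^^ P) ((f ^^ Suc k) \<alpha>)"
    unfolding \<beta>_def by (metis add.commute comp_apply funpow_add)
  then have "f x = f y" using P by (simp add: x_def y_def)
  then have pow: "x ^ d = y ^ d" by (simp add: f)
  have "y \<noteq> 0"
  proof
    assume "y = 0"
    then have "x = 0" using pow d_ge_2 by (simp add: power_0_left split: if_splits)
    then show False using \<open>x \<noteq> y\<close> \<open>y = 0\<close> by simp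
  qed
  \<comment> \<open>Here the periodicity of the critical point enters: \<open>y\<close> and 0 are
    distinct periodic points, hence incongruent modulo \<open>M\<close>.\<close>
  then have y_unit: "y \<notin> M"
    using periodic_eqI[OF y_per xy(2) zero_periodic] by auto
  define \<zeta> where "\<zeta> = x * inverse y"
  have \<zeta>: "\<zeta> \<in> V" "\<zeta> \<noteq> 1" "\<zeta> ^ (p ^ e) = 1"
  proof -
    show "\<zeta> \<in> V" unfolding \<zeta>_def using unit_inverse[OF xy(2) y_unit] xy(1) by blast
    show "\<zeta> \<noteq> 1" using \<open>x \<noteq> y\<close> \<open>y \<noteq> 0\<close> by (auto simp: \<zeta>_def field_simps)
    show "\<zeta> ^ (p ^ e) = 1"
      using pow \<open>y \<noteq> 0\<close> by (simp add: \<zeta>_def power_mult_distrib power_inverse d)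
  qed
  obtain w where w: "w \<in> V" "of_nat p = (\<zeta> - 1) * w"
    using root_of_unity_minus_one_dvd_prime[OF prime_p \<zeta>] by blast
  have "of_nat p = (x - y) * (inverse y * w)"
    using w(2) \<open>y \<noteq> 0\<close> by (simp add: \<zeta>_def field_simps)
  moreover have "inverse y * w \<in> V" using unit_inverse[OF xy(2) y_unit] w by auto
  ultimately have div: "\<exists>s\<in>V. of_nat p = ((f ^^ k) \<alpha> - (f ^^ k) \<beta>) * s"
    unfolding x_def y_def by blast
  \<comment> \<open>Since \<open>f x = f y\<close>, the expansion of \<open>f_diff\<close> makes
    this power a multiple of \<open>p\<close>.\<close>
  have "(x - y) ^ d \<in> M"
  proof -
    obtain v where "v \<in> V" "f x - f y = (x - y) ^ d + of_nat p * (x - y) * v"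
      using f_diff[OF xy] by blast
    then have "(x - y) ^ d = of_nat p * (- (x - y) * v)" "- (x - y) * v \<in> V"
      using \<open>f x = f y\<close> xy by (auto simp: algebra_simps eq_neg_iff_add_eq_0)
    then show ?thesis by (metis M_mult p_mem_M)
  qed
  then have "x - y \<in> M" using xy M_power[of "x - y" d] by auto
  then obtain s where "\<alpha> - \<beta> \<in> M" "s \<in> V" "of_nat p = (\<alpha> - \<beta>) ^ (d ^ k) * s"
    using f_pullback[OF \<alpha>V \<beta>V _ div] by (auto simp: x_def y_def)
  then have "CF.independent K (map (\<lambda>i. (\<alpha> - \<beta>) ^ i) [0..<d ^ k])"
    by (rule powers_independent)
  moreover have "set (map (\<lambda>i. (\<alpha> - \<beta>) ^ i) [0..<d ^ k]) \<subseteq> L"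
    using \<alpha>(1) \<beta>L by auto
  ultimately show ?thesis
    using CF.independent_length_le_dimension[OF subfield_K dim] by fastforce
qed

end

theorem corollary1p6:
  fixes p e d :: nat and b \<alpha> :: complex and f :: "complex \<Rightarrow> complex"
  assumes "Factorial_Ring.prime p" and "e \<ge> 1" and "d = p ^ e"
    and "algebraic b"
    and "f = (\<lambda>z. z ^ d + b)"
    and "periodic_point f 0"
    and "algebraic \<alpha>"
    and "preperiodic_point f \<alpha>"
  shows "real d powi (int (preper f \<alpha>) - 1)
           \<le> real (ext_degree (rat_adjoin {b, \<alpha>}) (rat_adjoin {b})) \<and>
         per f \<alpha>
           \<le> p * Lcm {residue_degree (rat_adjoin {b}) v | v.
                        v \<in> places (rat_adjoin {b}) \<and> place_above (rat_adjoin {b}) p v}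
               * ext_degree (rat_adjoin {b, \<alpha>}) (rat_adjoin {b})"
proof -
  obtain V where "valuation_subring V UNIV" "of_nat p \<in> valuation_subring.M V"
    using ex_valuation_subring[OF assms(1)] by blast
  then interpret unicritical V p e d b f
    using assms by (intro unicritical.intro unicritical_axioms.intro p_valuation_subring.intro
        p_valuation_subring_axioms.intro)
  define L where "L = rat_adjoin {b, \<alpha>}"
  have L: "subfield L complex_field" unfolding L_def by (rule subfield_rat_adjoin)
  have KL: "K \<subseteq> L"
    unfolding K_def L_def rat_adjoin_def by (intro field.mono_generate_field[OF complex_is_field]) auto
  have \<alpha>L: "\<alpha> \<in> L" unfolding L_def rat_adjoin_def by (rule generate_field.incl) simp
  interpret L: complex_subring L using L subfieldE(1) by (intro complex_subring.intro) blast
  obtain N\<^sub>0 where N0: "CF.dimension N\<^sub>0 \<rat> K"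
    using ex_dimension_rat_adjoin_singleton[OF assms(4)] unfolding K_def by blast
  obtain N where N: "CF.dimension N K L"
    using ex_dimension_rat_adjoin[OF assms(7), of "{b}"] unfolding K_def L_def by (auto simp: insert_commute)
  have deg: "ext_degree L K = N" by (rule ext_degree_eq[OF subfield_K N])
  have "N \<ge> 1"
  proof (rule ccontr)
    assume "\<not> N \<ge> 1"
    then have "L = {0}" using CF.dimension_zero[OF subfield_K] N by (cases N) auto
    then show False using L.one_mem by simp
  qed
  have "real d powi (int (preper f \<alpha>) - 1) \<le> real N"
  proof (cases "preper f \<alpha>")
    case 0
    \<comment> \<open>For a periodic point the exponent is -1, and the bound only needs
      \<open>N\<close> to be positive.\<close>
    have "real d powi (- 1) \<le> 1" using d_ge_2 by (simp add: power_int_minus field_simps)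
    then show ?thesis using 0 \<open>N \<ge> 1\<close> by simp
  next
    case (Suc k)
    then have "d ^ k \<le> N" using preper_bound[OF L KL N \<alpha>L assms(8)] by blast
    then have "real (d ^ k) \<le> real N" by (rule of_nat_mono)
    then show ?thesis using Suc by simp
  qed
  moreover have "per f \<alpha> \<le> p * Lcm {residue_degree K v | v. v \<in> places K \<and> place_above K p v} * N"
  proof -
    obtain t where t: "1 \<le> t" "t \<le> N" "\<And>x. x \<in> V \<inter> L \<Longrightarrow> x ^ (p ^ (residue_degree K vK * t)) - x \<in> M"
      using power_card_cong[OF N0 L KL N] by blast
    let ?r = "residue_degree K vK * t"
    define z where "z = (f ^^ preper f \<alpha>) \<alpha>"
    have bL: "b \<in> L" using b_mem_K KL by blast
    have "periodic_point f z"
      unfolding z_def preper_def using ex_periodic_iterate[OF assms(8)] by (rule LeastI_ex)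
    moreover have "z \<in> V" unfolding z_def using preperiodic_mem[OF assms(8)] by blast
    moreover have "(f ^^ i) \<alpha> \<in> L" for i using \<alpha>L bL by (induction i) (auto simp: f)
    then have "z \<in> L" by (simp add: z_def)
    ultimately have "(f ^^ (p * ?r)) z = z"
      using period_divides[OF L.subring bL t(3)] by blast
    \<comment> \<open>\<open>per\<close> is a least positive integer, so a usable return time must
      be nonzero.\<close>
    moreover have "p * ?r \<ge> 1"
      using prime_gt_0_nat[OF prime_p] card_resid_K(3)[OF N0] t(1) by simp
    ultimately have "per f \<alpha> \<le> p * ?r"
      unfolding per_def z_def by (intro Least_le) simp
    also have "\<dots> \<le> p * (Lcm {residue_degree K v | v. v \<in> places K \<and> place_above K p v} * N)"
      using residue_degree_le_Lcm[OF N0] t(2) by (intro mult_le_mono) auto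
    finally show ?thesis by (simp add: mult.assoc)
  qed
  ultimately show ?thesis
    using deg unfolding K_def L_def by simp
qed

end
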